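(* Suppose a group $G$ acts on a dendrite $X$ with no finite orbits. Then: (1) There is a unique infinite minimal set $M\subset X$. (2) If the action is dendro-minimal and $X$ has no free arc, then $M=X$. (3) The action of $G$ on $M$ is extremely proximal. (4) The action of $G$ on $X$ is proximal.
   Context: A dendron is a compact connected Hausdorff space $D$ in which every pair of distinct points $u,v$ is separated by a third point $w$, i.e. $D\setminus\{w\}$ is the union of two disjoint open sets containing $u$ and $v$ respectively; a dendrite is a metrizable dendron. Groups act by homeomorphisms. A minimal set is a nonempty closed $G$-invariant subset containing no proper subset of the same kind. An action of $G$ on a dendron $D$ is dendro-minimal if every $G$-invariant subdendron (subcontinuum) $C\subset D$ is either all of $D$ or the empty set. An arc is a subset homeomorphic to a nondegenerate compact real interval. A branch point of a dendrite is a point whose complement has at least three connected components. An arc $C$ in a dendrite is a free arc if it contains no branch points. A pair of points $x,y$ of a dynamical system $(G,X)$ is proximal if there are a net $g_i\in G$ and a point $z\in X$ with $\lim g_ix=\lim g_iy=z$; the system (action) is proximal if every pair of points in $X$ is proximal. An infinite minimal dynamical system $(G,M)$ is extremely proximal if for every nonempty closed subset $A\subsetneq M$ and every nonempty open subset $U\subset M$ there is $g\in G$ with $gA\subset U$. *)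

theory Defs
  imports "HOL-Analysis.Analysis" "HOL-Algebra.Group_Action"
begin

section \<open>Dendrons and dendrites\<close>

text \<open>Continua are taken to be nonempty; for the empty space the condition of having no finite
  orbits would hold vacuously.  In the separation clause it makes no difference whether \<open>U\<close> and
  \<open>V\<close> are required to be open in \<open>D\<close> or in \<open>D - {w}\<close>, as points of a Hausdorff space are closed.\<close>

definition dendron :: "'a topology \<Rightarrow> bool" where
  "dendron D \<longleftrightarrow>
     topspace D \<noteq> {} \<and> compact_space D \<and> connected_space D \<and> Hausdorff_space D \<and>
     (\<forall>u \<in> topspace D. \<forall>v \<in> topspace D. u \<noteq> v \<longrightarrow>
        (\<exists>w \<in> topspace D - {u, v}. \<exists>U V. openin D U \<and> openin D V \<and> U \<inter> V = {} \<and>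
           U \<union> V = topspace D - {w} \<and> u \<in> U \<and> v \<in> V))"

definition dendrite :: "'a topology \<Rightarrow> bool" where
  "dendrite X \<longleftrightarrow> dendron X \<and> metrizable_space X"

definition arc_set :: "'a topology \<Rightarrow> 'a set \<Rightarrow> bool" where
  "arc_set X C \<longleftrightarrow> C \<subseteq> topspace X \<and>
     (\<exists>a b :: real. a < b \<and> subtopology X C homeomorphic_space top_of_set {a..b})"

text \<open>The first disjunct is needed because \<open>card\<close> is zero on infinite sets.\<close>

definition branch_point :: "'a topology \<Rightarrow> 'a \<Rightarrow> bool" where
  "branch_point X x \<longleftrightarrow> x \<in> topspace X \<and>
     (let K = connected_components_of (subtopology X (topspace X - {x}))
      in infinite K \<or> 3 \<le> card K)"

definition free_arc :: "'a topology \<Rightarrow> 'a set \<Rightarrow> bool" where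
  "free_arc X C \<longleftrightarrow> arc_set X C \<and> (\<forall>x \<in> C. \<not> branch_point X x)"

section \<open>Actions by homeomorphisms\<close>

definition homeo_action ::
    "('g, 'm) monoid_scheme \<Rightarrow> 'a topology \<Rightarrow> ('g \<Rightarrow> 'a \<Rightarrow> 'a) \<Rightarrow> bool" where
  "homeo_action G X \<phi> \<longleftrightarrow>
     group_action G (topspace X) \<phi> \<and> (\<forall>g \<in> carrier G. homeomorphic_map X X (\<phi> g))"

definition invariant_set ::
    "('g, 'm) monoid_scheme \<Rightarrow> ('g \<Rightarrow> 'a \<Rightarrow> 'a) \<Rightarrow> 'a set \<Rightarrow> bool" where
  "invariant_set G \<phi> C \<longleftrightarrow> (\<forall>g \<in> carrier G. \<phi> g ` C \<subseteq> C)"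

definition minimal_set ::
    "('g, 'm) monoid_scheme \<Rightarrow> 'a topology \<Rightarrow> ('g \<Rightarrow> 'a \<Rightarrow> 'a) \<Rightarrow> 'a set \<Rightarrow> bool" where
  "minimal_set G X \<phi> M \<longleftrightarrow>
     M \<noteq> {} \<and> closedin X M \<and> invariant_set G \<phi> M \<and>
     \<not> (\<exists>N. N \<subset> M \<and> N \<noteq> {} \<and> closedin X N \<and> invariant_set G \<phi> N)"

definition dendro_minimal ::
    "('g, 'm) monoid_scheme \<Rightarrow> 'a topology \<Rightarrow> ('g \<Rightarrow> 'a \<Rightarrow> 'a) \<Rightarrow> bool" where
  "dendro_minimal G D \<phi> \<longleftrightarrow>
     (\<forall>C \<subseteq> topspace D. dendron (subtopology D C) \<and> invariant_set G \<phi> C \<longrightarrow>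
        C = topspace D \<or> C = {})"

text \<open>A net in the group is rendered by a proper filter \<open>F\<close> living on the carrier of \<open>G\<close>.\<close>

definition proximal_pair ::
    "('g, 'm) monoid_scheme \<Rightarrow> 'a topology \<Rightarrow> ('g \<Rightarrow> 'a \<Rightarrow> 'a) \<Rightarrow> 'a \<Rightarrow> 'a \<Rightarrow> bool" where
  "proximal_pair G X \<phi> x y \<longleftrightarrow>
     (\<exists>F z. F \<noteq> bot \<and> F \<le> principal (carrier G) \<and> z \<in> topspace X \<and>
        limitin X (\<lambda>g. \<phi> g x) z F \<and> limitin X (\<lambda>g. \<phi> g y) z F)"

definition proximal_action ::
    "('g, 'm) monoid_scheme \<Rightarrow> 'a topology \<Rightarrow> ('g \<Rightarrow> 'a \<Rightarrow> 'a) \<Rightarrow> bool" where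
  "proximal_action G X \<phi> \<longleftrightarrow>
     (\<forall>x \<in> topspace X. \<forall>y \<in> topspace X. proximal_pair G X \<phi> x y)"

definition extremely_proximal ::
    "('g, 'm) monoid_scheme \<Rightarrow> 'a topology \<Rightarrow> ('g \<Rightarrow> 'a \<Rightarrow> 'a) \<Rightarrow> bool" where
  "extremely_proximal G M \<phi> \<longleftrightarrow>
     homeo_action G M \<phi> \<and> infinite (topspace M) \<and> minimal_set G M \<phi> (topspace M) \<and>
     (\<forall>A U. closedin M A \<and> A \<noteq> {} \<and> A \<subset> topspace M \<and> openin M U \<and> U \<noteq> {} \<longrightarrow>
        (\<exists>g \<in> carrier G. \<phi> g ` A \<subseteq> U))"

text \<open>Elements of \<^const>\<open>BijGroup\<close> are extensional, so an action on a subset has to be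
  restricted explicitly.\<close>

definition restrict_action :: "('g \<Rightarrow> 'a \<Rightarrow> 'a) \<Rightarrow> 'a set \<Rightarrow> 'g \<Rightarrow> 'a \<Rightarrow> 'a" where
  "restrict_action \<phi> M = (\<lambda>g. restrict (\<phi> g) M)"

end

theory Submission
  imports Defs
begin

text \<open>
  Subcontinua of a dendron behave like subtrees: arbitrary intersections of them are connected,
  pairwise intersecting families of them have a common point (Helly), and every point \<open>m\<close> has a
  gate in a subcontinuum \<open>Y\<close>, i.e. a point of \<open>Y\<close> lying on every subcontinuum that joins \<open>m\<close> to \<open>Y\<close>.
  Off \<open>Y\<close> the gate is locally constant.

  Let \<open>Y\<close> be a minimal invariant subcontinuum.  A minimal set disjoint from \<open>Y\<close> would have finitely
  many gates, which form a finite invariant set; so all minimal sets lie in \<open>Y\<close>.  If all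
  translates of a proper subcontinuum \<open>K\<close> of \<open>Y\<close> met each other, Helly would give an invariant proper
  subcontinuum; so \<open>K\<close> has a translate disjoint from \<open>K\<close>, and in fact one disjoint from any given
  proper subcontinuum \<open>L\<close> of \<open>Y\<close>.  Now \<open>Y\<close> has an end, a point all of whose neighbourhoods contain the
  complement in \<open>Y\<close> of some proper subcontinuum.  Every minimal set contains every such end, and by
  minimality consists of ends; this gives uniqueness, and moving \<open>K\<close> off \<open>L\<close> gives extreme proximality
  on \<open>M\<close>.  Projecting a closed invariant subset of the square onto \<open>M\<close> twice reduces proximality of
  arbitrary pairs to pairs in \<open>M\<close>.

  If \<open>Y\<close> is the whole space and some segment misses \<open>M\<close>, then each interior branch point of that segment is the
  gate of a point of \<open>M\<close>, so there are only finitely many and the segment contains a free arc.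
\<close>

section \<open>Subcontinua of a dendron\<close>

lemma compact_space_Inter_nonempty:
  assumes "compact_space X" "\<A> \<noteq> {}" "\<And>A. A \<in> \<A> \<Longrightarrow> closedin X A"
    and "\<And>\<F>. finite \<F> \<Longrightarrow> \<F> \<subseteq> \<A> \<Longrightarrow> \<F> \<noteq> {} \<Longrightarrow> \<Inter>\<F> \<noteq> {}"
  shows "\<Inter>\<A> \<noteq> {}"
  using assms unfolding compact_space_fip by (metis Inter_empty UNIV_not_empty)

lemma compact_space_chain_Inter_nonempty:
  assumes "compact_space X" "\<A> \<noteq> {}" "\<And>A. A \<in> \<A> \<Longrightarrow> closedin X A \<and> A \<noteq> {}"
    and "\<And>A B. A \<in> \<A> \<Longrightarrow> B \<in> \<A> \<Longrightarrow> A \<subseteq> B \<or> B \<subseteq> A"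
  shows "\<Inter>\<A> \<noteq> {}"
proof (rule compact_space_Inter_nonempty)
  fix \<F> assume "finite \<F>" "\<F> \<subseteq> \<A>" "\<F> \<noteq> {}"
  then have "\<Inter>\<F> \<in> \<F>"
    by (intro Inter_in_chain[of _ \<A>]) (use assms(4) in \<open>auto simp: subset_chain_def\<close>)
  then show "\<Inter>\<F> \<noteq> {}" using assms \<open>\<F> \<subseteq> \<A>\<close> by blast
qed (use assms in auto)

text \<open>Zorn's lemma for reverse inclusion: compactness keeps the intersection of a chain
  nonempty, and \<open>chain\<close> then puts it into \<open>\<A>\<close>. It yields minimal sets
  as well as minimal invariant subcontinua.\<close>

lemma ex_minimal_closed_set:
  assumes X: "compact_space X" and S: "S \<in> \<A>"
    and cl: "\<And>A. A \<in> \<A> \<Longrightarrow> closedin X A \<and> A \<noteq> {}"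
    and chain: "\<And>\<C>. \<C> \<noteq> {} \<Longrightarrow> \<C> \<subseteq> \<A> \<Longrightarrow> \<Inter>\<C> \<noteq> {} \<Longrightarrow> \<Inter>\<C> \<in> \<A>"
  obtains M where "M \<in> \<A>" "M \<subseteq> S" "\<And>A. A \<in> \<A> \<Longrightarrow> A \<subseteq> M \<Longrightarrow> A = M"
proof -
  let ?B = "{A \<in> \<A>. A \<subseteq> S}"
  have "\<exists>m\<in>?B. \<forall>a\<in>?B. a \<subseteq> m \<longrightarrow> a = m"
  proof (rule predicate_Zorn)
    show "partial_order_on ?B (relation_of (\<lambda>x y. y \<subseteq> x) ?B)"
      by (rule partial_order_on_relation_ofI) auto
    fix C assume "C \<in> Chains (relation_of (\<lambda>x y. y \<subseteq> x) ?B)"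
    then have C: "C \<subseteq> ?B" "\<And>A B. A \<in> C \<Longrightarrow> B \<in> C \<Longrightarrow> A \<subseteq> B \<or> B \<subseteq> A"
      by (auto simp: Chains_def relation_of_def)
    show "\<exists>u\<in>?B. \<forall>a\<in>C. u \<subseteq> a"
    proof (cases "C = {}")
      case True
      then show ?thesis using S by auto
    next
      case False
      have "\<Inter>C \<noteq> {}"
        using C False cl by (intro compact_space_chain_Inter_nonempty [OF X]) blast+
      then have "\<Inter>C \<in> \<A>"
        using C False by (intro chain) auto
      moreover have "\<Inter>C \<subseteq> S" using C(1) False by blast
      ultimately show ?thesis by (intro bexI[of _ "\<Inter>C"] ballI Inter_lower) simp_all
    qed
  qed
  then obtain M where M: "M \<in> ?B" "\<forall>a\<in>?B. a \<subseteq> M \<longrightarrow> a = M" ..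
  show ?thesis
  proof (rule that)
    show "M \<in> \<A>" "M \<subseteq> S" using M(1) by auto
    show "A = M" if "A \<in> \<A>" "A \<subseteq> M" for A using that M by auto
  qed
qed

section \<open>Subcontinua and cuts\<close>

definition subcontinuum :: "'a topology \<Rightarrow> 'a set \<Rightarrow> bool" where
  "subcontinuum X K \<longleftrightarrow> closedin X K \<and> connectedin X K \<and> K \<noteq> {}"

lemma subcontinuum_subset: "subcontinuum X K \<Longrightarrow> K \<subseteq> topspace X"
  by (simp add: subcontinuum_def closedin_subset)

lemma subcontinuum_Un:
  "subcontinuum X K \<Longrightarrow> subcontinuum X L \<Longrightarrow> K \<inter> L \<noteq> {} \<Longrightarrow> subcontinuum X (K \<union> L)"
  by (auto simp: subcontinuum_def connectedin_Un)

text \<open>If two closed sets split \<open>insert w A\<close>, the piece without \<open>w\<close>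
  is closed in \<open>X\<close>, and it is open because it is \<open>A\<close> minus the other
  closed set. A connected space has no such set that is nonempty and misses
  \<open>w\<close>.\<close>

lemma subcontinuum_insert_side:
  assumes X: "connected_space X" and A: "openin X A" and B: "openin X B"
    and AB: "A \<inter> B = {}" "A \<union> B = topspace X - {w}" and w: "w \<in> topspace X"
  shows "subcontinuum X (insert w A)"
proof -
  have eq: "insert w A = topspace X - B"
    using AB w openin_subset[OF A] by auto
  then have cl: "closedin X (insert w A)" using B by auto
  have *: False if E: "closedin X E" "closedin X F" "insert w A \<subseteq> E \<union> F"
      "E \<inter> F \<inter> insert w A = {}" "F \<inter> insert w A \<noteq> {}" "w \<in> E" for E F
  proof -
    have "F \<inter> insert w A = A - E" using E by blast
    moreover have "openin X (A - E)" using A E by (simp add: openin_diff)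
    ultimately have "openin X (F \<inter> insert w A)" by simp
    moreover have "closedin X (F \<inter> insert w A)" using E(2) cl by (rule closedin_Int)
    moreover have "w \<notin> F \<inter> insert w A" using E by auto
    ultimately show False
      using X E(5) w unfolding connected_space_clopen_in by metis
  qed
  have "connectedin X (insert w A)"
    unfolding connectedin_closedin
  proof (intro conjI notI)
    show "insert w A \<subseteq> topspace X" using eq by auto
    assume "\<exists>E F. closedin X E \<and> closedin X F \<and> insert w A \<subseteq> E \<union> F \<and>
      E \<inter> F \<inter> insert w A = {} \<and> E \<inter> insert w A \<noteq> {} \<and> F \<inter> insert w A \<noteq> {}"
    then obtain E F where EF: "closedin X E" "closedin X F" "insert w A \<subseteq> E \<union> F"
      "E \<inter> F \<inter> insert w A = {}" "E \<inter> insert w A \<noteq> {}" "F \<inter> insert w A \<noteq> {}" by blast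
    show False
    proof (cases "w \<in> E")
      case True then show ?thesis using *[of E F] EF by blast
    next
      case False
      then have "w \<in> F" using EF by auto
      then show ?thesis using *[of F E] EF by blast
    qed
  qed
  then show ?thesis using cl by (simp add: subcontinuum_def)
qed

lemma connectedin_Un_closedin_meet:
  assumes "connectedin X (A \<union> B)" "closedin X A" "closedin X B" "A \<noteq> {}" "B \<noteq> {}"
  shows "A \<inter> B \<noteq> {}"
proof
  assume "A \<inter> B = {}"
  then have "\<exists>E F. closedin X E \<and> closedin X F \<and> A \<union> B \<subseteq> E \<union> F \<and>
      E \<inter> F \<inter> (A \<union> B) = {} \<and> E \<inter> (A \<union> B) \<noteq> {} \<and> F \<inter> (A \<union> B) \<noteq> {}"
    using assms by (intro exI[of _ A] exI[of _ B]) auto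
  then show False using assms(1) unfolding connectedin_closedin by blast
qed

locale dendron_space =
  fixes X :: "'a topology"
  assumes dendron: "dendron X"
begin

lemma compact: "compact_space X" and connected: "connected_space X"
  and Hausdorff: "Hausdorff_space X" and nonempty: "topspace X \<noteq> {}"
  using dendron by (auto simp: dendron_def)

lemma t1: "t1_space X"
  using Hausdorff Hausdorff_imp_t1_space by blast

lemma subcontinuum_topspace: "subcontinuum X (topspace X)"
  using connected nonempty by (simp add: subcontinuum_def connectedin_topspace)

lemma subcontinuum_singleton: "x \<in> topspace X \<Longrightarrow> subcontinuum X {x}"
  using t1 by (simp add: subcontinuum_def closedin_t1_singleton)

text \<open>Putting the cut point back into both open halves of the axiom makes the two sides
  subcontinua. A connected set through \<open>u\<close> and \<open>v\<close> that avoids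
  \<open>w\<close> would be split by the open halves.\<close>

lemma separation:
  assumes "u \<in> topspace X" "v \<in> topspace X" "u \<noteq> v"
  obtains w K L where "subcontinuum X K" "subcontinuum X L" "K \<union> L = topspace X"
    "K \<inter> L = {w}" "u \<notin> L" "v \<notin> K" "\<And>C. connectedin X C \<Longrightarrow> u \<in> C \<Longrightarrow> v \<in> C \<Longrightarrow> w \<in> C"
proof -
  obtain w U V where w: "w \<in> topspace X" "w \<noteq> u" "w \<noteq> v" and U: "openin X U" and V: "openin X V"
    and UV: "U \<inter> V = {}" "U \<union> V = topspace X - {w}" "u \<in> U" "v \<in> V"
    using dendron assms unfolding dendron_def by (metis Diff_iff insert_iff)
  have UX: "U \<subseteq> topspace X" and VX: "V \<subseteq> topspace X" using U V openin_subset by auto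
  show ?thesis
  proof
    show "subcontinuum X (insert w U)"
      by (rule subcontinuum_insert_side[OF connected U V UV(1,2) w(1)])
    show "subcontinuum X (insert w V)"
      using subcontinuum_insert_side[OF connected V U _ _ w(1)] UV by (metis Int_commute Un_commute)
    show "insert w U \<union> insert w V = topspace X" "insert w U \<inter> insert w V = {w}"
      "u \<notin> insert w V" "v \<notin> insert w U" using UV w by auto
    fix C assume C: "connectedin X C" "u \<in> C" "v \<in> C"
    show "w \<in> C"
    proof (rule ccontr)
      assume "w \<notin> C"
      then have "C \<subseteq> U \<union> V" using connectedin_subset_topspace[OF C(1)] UV by blast
      then show False using C U V UV unfolding connectedin by blast
    qed
  qed
qed

text \<open>The side of a cut that contains \<open>y\<close> is a neighbourhood of \<open>y\<close>,
  as it includes the complement of the other, closed side.\<close>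

lemma subcontinuum_nbhd_avoiding_point:
  assumes "y \<in> topspace X" "x \<in> topspace X" "y \<noteq> x"
  obtains K U where "subcontinuum X K" "openin X U" "y \<in> U" "U \<subseteq> K" "x \<notin> K"
proof -
  obtain w K L where KL: "subcontinuum X K" "subcontinuum X L" "K \<union> L = topspace X"
    "K \<inter> L = {w}" "y \<notin> L" "x \<notin> K"
    using separation[OF assms] by metis
  show ?thesis
  proof
    show "subcontinuum X K" "x \<notin> K" by fact+
    show "openin X (topspace X - L)" using KL by (auto simp: subcontinuum_def)
    show "y \<in> topspace X - L" "topspace X - L \<subseteq> K" using KL assms by auto
  qed
qed

section \<open>Segments and the order seen from a point\<close>

text \<open>A hull of this kind needs no construction of paths. That it is connected follows only
  with \<open>subcontinuum_seg\<close>; before that, just its closedness is available.\<close>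

definition seg :: "'a \<Rightarrow> 'a \<Rightarrow> 'a set" where
  "seg a b = \<Inter>{K. subcontinuum X K \<and> a \<in> K \<and> b \<in> K}"

lemma mem_seg: "x \<in> seg a b \<longleftrightarrow> (\<forall>K. subcontinuum X K \<longrightarrow> a \<in> K \<longrightarrow> b \<in> K \<longrightarrow> x \<in> K)"
  by (auto simp: seg_def)

lemma seg_commute: "seg a b = seg b a"
  by (auto simp: mem_seg)

lemma seg_left [simp]: "a \<in> seg a b" and seg_right [simp]: "b \<in> seg a b"
  by (auto simp: mem_seg)

lemma seg_subset: "subcontinuum X K \<Longrightarrow> a \<in> K \<Longrightarrow> b \<in> K \<Longrightarrow> seg a b \<subseteq> K"
  by (auto simp: mem_seg)

text \<open>Transitivity of the order from \<open>a\<close>, in which \<open>c\<close> precedes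
  \<open>b\<close> if \<open>c \<in> seg a b\<close>.\<close>

lemma seg_trans: "c \<in> seg a b \<Longrightarrow> seg a c \<subseteq> seg a b"
  by (auto simp: mem_seg)

lemma seg_subset_topspace:
  "a \<in> topspace X \<Longrightarrow> b \<in> topspace X \<Longrightarrow> seg a b \<subseteq> topspace X"
  using seg_subset subcontinuum_topspace by blast

lemma closedin_seg: 
  assumes "a \<in> topspace X" "b \<in> topspace X" shows "closedin X (seg a b)"
  unfolding seg_def
  by (rule closedin_Inter) (use assms subcontinuum_topspace in \<open>auto simp: subcontinuum_def\<close>)

text \<open>Cut between \<open>x\<close> and \<open>y\<close>: the side with \<open>a\<close> in it
  contains one of the two points, hence the segment from \<open>a\<close> to it, but misses the
  other.\<close>

lemma seg_antisym:
  assumes "a \<in> topspace X" "x \<in> topspace X" "y \<in> topspace X" "x \<in> seg a y" "y \<in> seg a x"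
  shows "x = y"
proof (rule ccontr)
  assume "x \<noteq> y"
  then obtain w K L where KL: "subcontinuum X K" "subcontinuum X L" "K \<union> L = topspace X"
    "K \<inter> L = {w}" "x \<notin> L" "y \<notin> K"
    using separation[OF assms(2,3)] by metis
  then have "a \<in> K \<or> a \<in> L" using assms by auto
  then show False using assms KL unfolding mem_seg by blast
qed

text \<open>Zorn's lemma for the order from \<open>q\<close>: along a chain the sets
  \<open>P \<inter> seg q y\<close> are nested, closed and nonempty, so by compactness they have a
  common point.\<close>

lemma ex_nearest_point:
  assumes q: "q \<in> topspace X" and P: "closedin X P" "P \<noteq> {}"
  obtains p where "p \<in> P" "P \<inter> seg q p = {p}"
proof -
  have PX: "P \<subseteq> topspace X" using P closedin_subset by auto
  \<comment> \<open>The relation runs towards \<open>q\<close>, so that a maximal element is a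
    nearest point.\<close>
  have "\<exists>m\<in>P. \<forall>a\<in>P. a \<in> seg q m \<longrightarrow> a = m"
  proof (rule predicate_Zorn)
    show "partial_order_on P (relation_of (\<lambda>x y. y \<in> seg q x) P)"
    proof (rule partial_order_on_relation_ofI)
      show "c \<in> seg q a" if "b \<in> seg q a" "c \<in> seg q b" for a b c
        using that seg_trans by blast
      show "a = b" if "a \<in> P" "b \<in> P" "b \<in> seg q a" "a \<in> seg q b" for a b
        using that seg_antisym[OF q, of a b] PX by auto
    qed simp
    fix C assume "C \<in> Chains (relation_of (\<lambda>x y. y \<in> seg q x) P)"
    then have C: "C \<subseteq> P" "\<And>x y. x \<in> C \<Longrightarrow> y \<in> C \<Longrightarrow> x \<in> seg q y \<or> y \<in> seg q x"
      by (auto simp: Chains_def relation_of_def)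
    show "\<exists>u\<in>P. \<forall>a\<in>C. u \<in> seg q a"
    proof (cases "C = {}")
      case True then show ?thesis using P by auto
    next
      case False
      have "\<Inter>((\<lambda>y. P \<inter> seg q y) ` C) \<noteq> {}"
      proof (rule compact_space_chain_Inter_nonempty[OF compact])
        fix A assume "A \<in> (\<lambda>y. P \<inter> seg q y) ` C"
        then obtain y where y: "y \<in> C" "A = P \<inter> seg q y" by auto
        then have "closedin X (seg q y)" using C PX q by (intro closedin_seg) auto
        moreover have "y \<in> A" using y C by auto
        ultimately show "closedin X A \<and> A \<noteq> {}" using y P by blast
      next
        fix A B assume "A \<in> (\<lambda>y. P \<inter> seg q y) ` C" "B \<in> (\<lambda>y. P \<inter> seg q y) ` C"
        then show "A \<subseteq> B \<or> B \<subseteq> A" using C(2) seg_trans by blast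
      qed (use False in simp)
      then show ?thesis using False by auto
    qed
  qed
  then obtain m where "m \<in> P" "\<forall>a\<in>P. a \<in> seg q m \<longrightarrow> a = m" by blast
  then have "P \<inter> seg q m = {m}" by auto
  then show ?thesis using that \<open>m \<in> P\<close> by blast
qed

text \<open>If the intersection split into \<open>P\<close> and \<open>Q\<close>, then a pair \<open>p \<in> P\<close>, \<open>q \<in> Q\<close> with no further point
  of \<open>P \<union> Q\<close> on the segment between them would be separated by a point of \<open>P \<union> Q\<close> on that segment.\<close>

lemma connectedin_Inter_subcontinua:
  assumes "\<F> \<noteq> {}" and F: "\<And>K. K \<in> \<F> \<Longrightarrow> subcontinuum X K"
  shows "connectedin X (\<Inter>\<F>)"
  unfolding connectedin_closedin
proof (intro conjI notI)
  have clF: "closedin X (\<Inter>\<F>)" using assms by (intro closedin_Inter) (auto simp: subcontinuum_def)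
  then show FX: "\<Inter>\<F> \<subseteq> topspace X" by (rule closedin_subset)
  assume "\<exists>E F. closedin X E \<and> closedin X F \<and> \<Inter>\<F> \<subseteq> E \<union> F \<and>
      E \<inter> F \<inter> \<Inter>\<F> = {} \<and> E \<inter> \<Inter>\<F> \<noteq> {} \<and> F \<inter> \<Inter>\<F> \<noteq> {}"
  then obtain E F where EF: "closedin X E" "closedin X F" "\<Inter>\<F> \<subseteq> E \<union> F"
      "E \<inter> F \<inter> \<Inter>\<F> = {}" "E \<inter> \<Inter>\<F> \<noteq> {}" "F \<inter> \<Inter>\<F> \<noteq> {}" by blast
  define P where "P = E \<inter> \<Inter>\<F>"
  define Q where "Q = F \<inter> \<Inter>\<F>"
  have PQ: "closedin X P" "closedin X Q" "P \<inter> Q = {}" "\<Inter>\<F> = P \<union> Q"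
    using EF clF by (auto simp: P_def Q_def)
  obtain q0 where q0: "q0 \<in> Q" using EF(6) unfolding Q_def by blast
  have sub: "P \<subseteq> topspace X" "Q \<subseteq> topspace X" using PQ(1,2) by (auto dest: closedin_subset)
  obtain p where p: "p \<in> P" "P \<inter> seg q0 p = {p}"
    using ex_nearest_point[of q0 P] q0 sub PQ EF(5) unfolding P_def by blast
  \<comment> \<open>The pair is found in two rounds: after \<open>p\<close> is chosen nearest to
    \<open>q0\<close>, \<open>q\<close> is chosen nearest to \<open>p\<close> among the points of
    \<open>Q\<close> between them.\<close>
  have clQ: "closedin X (Q \<inter> seg p q0)" using PQ p sub q0 by (intro closedin_Int closedin_seg) auto
  obtain q where q: "q \<in> Q \<inter> seg p q0" "(Q \<inter> seg p q0) \<inter> seg p q = {q}"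
    by (rule ex_nearest_point[OF _ clQ, of p]) (use p sub q0 in auto)
  have seg_sub: "seg p q \<subseteq> seg q0 p" using q seg_trans seg_commute by blast
  have "p \<in> topspace X" "q \<in> topspace X" "p \<noteq> q" using p q sub PQ by auto
  then obtain w K L where w: "subcontinuum X K" "subcontinuum X L" "K \<union> L = topspace X"
    "K \<inter> L = {w}" "p \<notin> L" "q \<notin> K" and sep: "\<And>C. connectedin X C \<Longrightarrow> p \<in> C \<Longrightarrow> q \<in> C \<Longrightarrow> w \<in> C"
    using separation by metis
  have wseg: "w \<in> seg p q" using sep by (auto simp: mem_seg subcontinuum_def)
  have "p \<in> \<Inter>\<F>" "q \<in> \<Inter>\<F>" using p q unfolding PQ(4) by auto
  then have "w \<in> \<Inter>\<F>" using sep F unfolding subcontinuum_def by blast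
  then have "w \<in> P \<or> w \<in> Q" using PQ by auto
  then have "w = p \<or> w = q" using wseg seg_sub p q seg_commute by blast
  then show False using w by auto
qed

section \<open>Intersections and the Helly property\<close>

lemma subcontinuum_Inter:
  assumes "\<F> \<noteq> {}" "\<And>K. K \<in> \<F> \<Longrightarrow> subcontinuum X K" "\<Inter>\<F> \<noteq> {}"
  shows "subcontinuum X (\<Inter>\<F>)"
  using assms connectedin_Inter_subcontinua[of \<F>] by (auto simp: subcontinuum_def intro: closedin_Inter)

lemma subcontinuum_Int:
  "subcontinuum X K \<Longrightarrow> subcontinuum X L \<Longrightarrow> K \<inter> L \<noteq> {} \<Longrightarrow> subcontinuum X (K \<inter> L)"
  using subcontinuum_Inter[of "{K, L}"] by auto

lemma subcontinuum_seg: "a \<in> topspace X \<Longrightarrow> b \<in> topspace X \<Longrightarrow> subcontinuum X (seg a b)"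
  unfolding seg_def
  by (rule subcontinuum_Inter) (use subcontinuum_topspace in auto)

text \<open>The connected set \<open>(A \<union> B) \<inter> C\<close> is the union of the closed
  nonempty sets \<open>A \<inter> C\<close> and \<open>B \<inter> C\<close>, which must therefore
  meet.\<close>

lemma Helly_triple:
  assumes "subcontinuum X A" "subcontinuum X B" "subcontinuum X C"
    "A \<inter> B \<noteq> {}" "B \<inter> C \<noteq> {}" "A \<inter> C \<noteq> {}"
  shows "A \<inter> B \<inter> C \<noteq> {}"
proof -
  have "(A \<union> B) \<inter> C = (A \<inter> C) \<union> (B \<inter> C)" by blast
  moreover have "subcontinuum X ((A \<union> B) \<inter> C)"
    using assms by (intro subcontinuum_Int subcontinuum_Un) auto
  ultimately have "connectedin X ((A \<inter> C) \<union> (B \<inter> C))" by (simp add: subcontinuum_def)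
  moreover have "closedin X (A \<inter> C)" "closedin X (B \<inter> C)" using assms by (auto simp: subcontinuum_def)
  ultimately have "(A \<inter> C) \<inter> (B \<inter> C) \<noteq> {}"
    using assms by (intro connectedin_Un_closedin_meet[of X "A \<inter> C"])
  then show ?thesis by blast
qed

lemma Helly_finite:
  assumes "finite I" "I \<noteq> {}" "\<And>i. i \<in> I \<Longrightarrow> subcontinuum X (f i)"
    "\<And>i j. i \<in> I \<Longrightarrow> j \<in> I \<Longrightarrow> f i \<inter> f j \<noteq> {}"
  shows "(\<Inter>i\<in>I. f i) \<noteq> {}"
  using assms
proof (induction arbitrary: f rule: finite_ne_induct)
  case (singleton x)
  then show ?case by fastforce
next
  case (insert x I)
  \<comment> \<open>The induction hypothesis is used for the traces on \<open>f x\<close>;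
    \<open>Helly_triple\<close> keeps these pairwise intersecting.\<close>
  have "(\<Inter>i\<in>I. f x \<inter> f i) \<noteq> {}"
  proof (rule insert.IH)
    show "subcontinuum X (f x \<inter> f i)" if "i \<in> I" for i
      using insert.prems that by (intro subcontinuum_Int) auto
    show "f x \<inter> f i \<inter> (f x \<inter> f j) \<noteq> {}" if "i \<in> I" "j \<in> I" for i j
      using Helly_triple[of "f x" "f i" "f j"] insert.prems that by (simp add: Int_ac)
  qed
  then show ?case using insert.hyps by auto
qed

lemma Helly:
  assumes "\<F> \<noteq> {}" "\<And>K. K \<in> \<F> \<Longrightarrow> subcontinuum X K"
    "\<And>K L. K \<in> \<F> \<Longrightarrow> L \<in> \<F> \<Longrightarrow> K \<inter> L \<noteq> {}"
  shows "\<Inter>\<F> \<noteq> {}"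
proof (rule compact_space_Inter_nonempty[OF compact])
  fix \<G> assume "finite \<G>" "\<G> \<subseteq> \<F>" "\<G> \<noteq> {}"
  then show "\<Inter>\<G> \<noteq> {}"
    using Helly_finite[of \<G> "\<lambda>K. K"] assms(2,3) by (metis image_ident subsetD)
qed (use assms in \<open>auto simp: subcontinuum_def\<close>)

text \<open>There are no circuits: if \<open>L\<close> and \<open>L'\<close> were disjoint, the
  connected set \<open>(L \<union> K') \<inter> (L' \<union> K)\<close> would fall apart into the
  disjoint closed sets \<open>L \<inter> K\<close> and \<open>L' \<inter> K'\<close>.\<close>

lemma subcontinua_crossing:
  assumes "subcontinuum X K" "subcontinuum X K'" "subcontinuum X L" "subcontinuum X L'"
    "K \<inter> K' = {}" "L \<inter> K \<noteq> {}" "L \<inter> K' \<noteq> {}" "L' \<inter> K \<noteq> {}" "L' \<inter> K' \<noteq> {}"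
  shows "L \<inter> L' \<noteq> {}"
proof
  assume LL: "L \<inter> L' = {}"
  have "subcontinuum X ((L \<union> K') \<inter> (L' \<union> K))"
    using assms by (intro subcontinuum_Int subcontinuum_Un) auto
  moreover have "(L \<union> K') \<inter> (L' \<union> K) = (L \<inter> K) \<union> (L' \<inter> K')"
    using LL assms by blast
  ultimately have con: "connectedin X ((L \<inter> K) \<union> (L' \<inter> K'))" by (simp add: subcontinuum_def)
  have "closedin X (L \<inter> K)" "closedin X (L' \<inter> K')" using assms by (auto simp: subcontinuum_def)
  then have "(L \<inter> K) \<inter> (L' \<inter> K') \<noteq> {}"
    using con assms by (intro connectedin_Un_closedin_meet[of X "L \<inter> K"])
  then show False using LL by blast
qed

text \<open>Cut \<open>m\<close> off from each point of \<open>C\<close>. By compactness finitely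
  many cuts suffice; \<open>N\<close> is the intersection of their sides towards \<open>m\<close>,
  and \<open>U\<close> is the complement of the far sides.\<close>

lemma subcontinuum_nbhd_avoiding_closed:
  assumes m: "m \<in> topspace X" and C: "closedin X C" "m \<notin> C"
  obtains N U where "subcontinuum X N" "openin X U" "m \<in> U" "U \<subseteq> N" "N \<inter> C = {}"
proof (cases "C = {}")
  case True
  show ?thesis by (rule that[of "topspace X" "topspace X"])
      (use True m subcontinuum_topspace in auto)
next
  case False
  have CX: "C \<subseteq> topspace X" using C closedin_subset by auto
  have "\<forall>y\<in>C. \<exists>K L. subcontinuum X K \<and> subcontinuum X L \<and> K \<union> L = topspace X \<and> m \<notin> L \<and> y \<notin> K"
    using separation[OF m] C CX by (metis subsetD)
  then obtain K L where KL: "\<And>y. y \<in> C \<Longrightarrow> subcontinuum X (K y) \<and> subcontinuum X (L y) \<and>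
      K y \<union> L y = topspace X \<and> m \<notin> L y \<and> y \<notin> K y" by metis
  have "compactin X C" using C compact closedin_compact_space by blast
  then obtain \<F> where F: "finite \<F>" "\<F> \<subseteq> (\<lambda>y. topspace X - K y) ` C" "C \<subseteq> \<Union>\<F>"
    using compactinD[of X C "(\<lambda>y. topspace X - K y) ` C"] KL CX
    by (smt (verit, ccfv_threshold) DiffI UN_I closedin_def imageE subcontinuum_def subsetD subsetI)
  then obtain D where D: "finite D" "D \<subseteq> C" "C \<subseteq> (\<Union>y\<in>D. topspace X - K y)"
    using finite_subset_image[OF F(1,2)] by auto
  \<comment> \<open>An intersection over an empty \<open>D\<close> would be
    \<open>UNIV\<close>.\<close>
  have "D \<noteq> {}" using D False by auto
  have mK: "m \<in> K y" if "y \<in> D" for y using KL[of y] that D m by auto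
  show ?thesis
  proof
    have "m \<in> \<Inter>(K ` D)" using mK by auto
    then have "\<Inter>(K ` D) \<noteq> {}" by blast
    then show "subcontinuum X (\<Inter>(K ` D))"
      using D(2) KL \<open>D \<noteq> {}\<close> by (intro subcontinuum_Inter) blast+
    show "openin X (\<Inter>y\<in>D. topspace X - L y)"
    proof (rule openin_INT2)
      fix y assume "y \<in> D"
      then have "closedin X (L y)" using KL[of y] D by (auto simp: subcontinuum_def)
      then show "openin X (topspace X - L y)" by blast
    qed (use D \<open>D \<noteq> {}\<close> in auto)
    show "m \<in> (\<Inter>y\<in>D. topspace X - L y)" using m KL D by auto
    show "(\<Inter>y\<in>D. topspace X - L y) \<subseteq> \<Inter>(K ` D)" using KL D by blast
    show "\<Inter>(K ` D) \<inter> C = {}" using D by auto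
  qed
qed

lemma subcontinuum_nbhd:
  assumes "openin X V" "m \<in> V"
  obtains N U where "subcontinuum X N" "openin X U" "m \<in> U" "U \<subseteq> N" "N \<subseteq> V"
proof -
  obtain N U where N: "subcontinuum X N" "openin X U" "m \<in> U" "U \<subseteq> N" "N \<inter> (topspace X - V) = {}"
    using subcontinuum_nbhd_avoiding_closed[of m "topspace X - V"] assms openin_subset[OF assms(1)] by blast
  have "N \<subseteq> V" using N(5) subcontinuum_subset[OF N(1)] by auto
  then show ?thesis using that N by blast
qed

section \<open>Gates\<close>

text \<open>This is the first point map onto \<open>Y\<close>. For a subcontinuum \<open>Y\<close>,
  uniqueness is in \<open>gate_eqI\<close> and existence in \<open>gate\<close>.\<close>

definition gate :: "'a set \<Rightarrow> 'a \<Rightarrow> 'a" where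
  "gate Y m = (THE r. r \<in> Y \<and> (\<forall>K. subcontinuum X K \<longrightarrow> m \<in> K \<longrightarrow> K \<inter> Y \<noteq> {} \<longrightarrow> r \<in> K))"

text \<open>Cut a second candidate \<open>s\<close> off from \<open>r\<close>: the side with
  \<open>m\<close> in it contains one of them, so it meets \<open>Y\<close>, but it misses the
  other.\<close>

lemma gate_eqI:
  assumes Y: "subcontinuum X Y" and m: "m \<in> topspace X" and r: "r \<in> Y"
    "\<And>K. subcontinuum X K \<Longrightarrow> m \<in> K \<Longrightarrow> K \<inter> Y \<noteq> {} \<Longrightarrow> r \<in> K"
  shows "gate Y m = r"
  unfolding gate_def
proof (rule the_equality)
  fix s assume s: "s \<in> Y \<and> (\<forall>K. subcontinuum X K \<longrightarrow> m \<in> K \<longrightarrow> K \<inter> Y \<noteq> {} \<longrightarrow> s \<in> K)"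
  show "s = r"
  proof (rule ccontr)
    assume "s \<noteq> r"
    moreover have "s \<in> topspace X" "r \<in> topspace X" using r s Y subcontinuum_subset by auto
    ultimately obtain w K L where w: "subcontinuum X K" "subcontinuum X L" "K \<union> L = topspace X"
      "K \<inter> L = {w}" "s \<notin> L" "r \<notin> K" using separation by metis
    then have "m \<in> K \<or> m \<in> L" using m by auto
    moreover have "s \<in> K" "r \<in> L" using w \<open>s \<in> topspace X\<close> \<open>r \<in> topspace X\<close> by auto
    ultimately show False using s r w by blast
  qed
qed (use r in auto)

text \<open>Helly's property for \<open>Y\<close> and all subcontinua joining \<open>m\<close> to
  \<open>Y\<close>: any two of the latter share \<open>m\<close>.\<close>

lemma gate:
  assumes Y: "subcontinuum X Y" and m: "m \<in> topspace X"
  shows gate_in: "gate Y m \<in> Y"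
    and gate_mem: "\<And>K. subcontinuum X K \<Longrightarrow> m \<in> K \<Longrightarrow> K \<inter> Y \<noteq> {} \<Longrightarrow> gate Y m \<in> K"
proof -
  let ?F = "insert Y {K. subcontinuum X K \<and> m \<in> K \<and> K \<inter> Y \<noteq> {}}"
  have "\<Inter>?F \<noteq> {}"
    using Y by (intro Helly) (auto simp: subcontinuum_def)
  then obtain r where r: "r \<in> \<Inter>?F" by blast
  then have "gate Y m = r" by (intro gate_eqI[OF Y m]) auto
  then show "gate Y m \<in> Y" "\<And>K. subcontinuum X K \<Longrightarrow> m \<in> K \<Longrightarrow> K \<inter> Y \<noteq> {} \<Longrightarrow> gate Y m \<in> K"
    using r by auto
qed

text \<open>Around \<open>m\<close> take a subcontinuum \<open>N\<close> off \<open>Y\<close>.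
  Joining \<open>N\<close> to a subcontinuum \<open>K\<close> from \<open>x \<in> N\<close> to
  \<open>Y\<close> gives one from \<open>m\<close> to \<open>Y\<close>, so the gate of
  \<open>m\<close> lies in \<open>K \<union> N\<close>, hence in \<open>K\<close>. Thus the gate is
  locally constant on the compact set \<open>M\<close>.\<close>

lemma finite_gate_image:
  assumes Y: "subcontinuum X Y" and M: "closedin X M" "M \<inter> Y = {}"
  shows "finite (gate Y ` M)"
proof -
  have MX: "M \<subseteq> topspace X" using M closedin_subset by auto
  have "\<forall>m\<in>M. \<exists>U. openin X U \<and> m \<in> U \<and> (\<forall>x\<in>U. gate Y x = gate Y m)"
  proof
    fix m assume "m \<in> M"
    then have m: "m \<in> topspace X" "m \<notin> Y" using M MX by auto
    obtain N U where N: "subcontinuum X N" "openin X U" "m \<in> U" "U \<subseteq> N" "N \<inter> Y = {}"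
      using subcontinuum_nbhd_avoiding_closed[OF m(1) _ m(2)] Y by (metis subcontinuum_def)
    have "gate Y x = gate Y m" if "x \<in> U" for x
    proof (rule gate_eqI[OF Y])
      show "x \<in> topspace X" using that N openin_subset by blast
      show "gate Y m \<in> Y" by (rule gate_in[OF Y m(1)])
      fix K assume K: "subcontinuum X K" "x \<in> K" "K \<inter> Y \<noteq> {}"
      then have "subcontinuum X (K \<union> N)" using N that by (intro subcontinuum_Un) auto
      then have "gate Y m \<in> K \<union> N" using K N by (intro gate_mem[OF Y m(1)]) auto
      then show "gate Y m \<in> K" using N gate_in[OF Y m(1)] by auto
    qed
    then show "\<exists>U. openin X U \<and> m \<in> U \<and> (\<forall>x\<in>U. gate Y x = gate Y m)" using N by blast
  qed
  then obtain U where U: "\<And>m. m \<in> M \<Longrightarrow> openin X (U m) \<and> m \<in> U m \<and> (\<forall>x\<in>U m. gate Y x = gate Y m)"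
    by metis
  have "compactin X M" using M compact closedin_compact_space by blast
  then obtain \<F> where F: "finite \<F>" "\<F> \<subseteq> U ` M" "M \<subseteq> \<Union>\<F>"
    using compactinD[of X M "U ` M"] U by blast
  then obtain D where D: "finite D" "D \<subseteq> M" "M \<subseteq> (\<Union>y\<in>D. U y)"
    using finite_subset_image[OF F(1,2)] by auto
  have "gate Y ` M \<subseteq> gate Y ` D"
  proof
    fix r assume "r \<in> gate Y ` M"
    then obtain m where m: "m \<in> M" "r = gate Y m" by auto
    then obtain d where "d \<in> D" "m \<in> U d" using D by auto
    then show "r \<in> gate Y ` D" using U[of d] D m by auto
  qed
  then show ?thesis using D(1) by (meson finite_imageI finite_subset)
qed

text \<open>The end is a maximal element of the order in which \<open>x\<close> precedes \<open>y\<close> if \<open>x \<in> seg a y\<close>: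
  every other point can be joined to \<open>a\<close> by a subcontinuum that avoids it.\<close>

lemma ex_end_point:
  assumes "a \<in> topspace X" "b \<in> topspace X" "a \<noteq> b"
  obtains e where "e \<in> topspace X" "\<And>V. openin X V \<Longrightarrow> e \<in> V \<Longrightarrow>
    \<exists>K. subcontinuum X K \<and> K \<noteq> topspace X \<and> topspace X - K \<subseteq> V"
proof -
  \<comment> \<open>These upper sets supply the bounds of chains. Each is closed because a
    subcontinuum from \<open>a\<close> to \<open>y\<close> that avoids \<open>x\<close> can be
    enlarged by a neighbourhood of \<open>y\<close> that avoids \<open>x\<close>.\<close>
  have closed: "closedin X {y \<in> topspace X. x \<in> seg a y}" if x: "x \<in> topspace X" for x
  proof -
    have "openin X {y \<in> topspace X. x \<notin> seg a y}"
    proof (subst openin_subopen, intro ballI)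
      fix y assume "y \<in> {y \<in> topspace X. x \<notin> seg a y}"
      then obtain K where y: "y \<in> topspace X" and K: "subcontinuum X K" "a \<in> K" "y \<in> K" "x \<notin> K"
        by (auto simp: mem_seg)
      then have "y \<noteq> x" by auto
      then obtain K' U where K': "subcontinuum X K'" "openin X U" "y \<in> U" "U \<subseteq> K'" "x \<notin> K'"
        using subcontinuum_nbhd_avoiding_point[OF y x] by metis
      have "subcontinuum X (K \<union> K')" using K K' by (intro subcontinuum_Un) auto
      then have "x \<notin> seg a z" if "z \<in> U" for z
        using K K' that unfolding mem_seg by (intro notI) (metis UnE UnI1 UnI2 subsetD)
      then have "U \<subseteq> {y \<in> topspace X. x \<notin> seg a y}"
        using openin_subset[OF K'(2)] by auto
      then show "\<exists>T. openin X T \<and> y \<in> T \<and> T \<subseteq> {y \<in> topspace X. x \<notin> seg a y}" using K' by blast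
    qed
    moreover have "{y \<in> topspace X. x \<in> seg a y} = topspace X - {y \<in> topspace X. x \<notin> seg a y}" by auto
    ultimately show ?thesis by (simp add: closedin_diff)
  qed
  have "\<exists>m\<in>topspace X. \<forall>y\<in>topspace X. m \<in> seg a y \<longrightarrow> y = m"
  proof (rule predicate_Zorn)
    show "partial_order_on (topspace X) (relation_of (\<lambda>x y. x \<in> seg a y) (topspace X))"
    proof (rule partial_order_on_relation_ofI)
      show "x \<in> seg a z" if "x \<in> seg a y" "y \<in> seg a z" for x y z
        using that seg_trans by blast
      show "x = y" if "x \<in> topspace X" "y \<in> topspace X" "x \<in> seg a y" "y \<in> seg a x" for x y
        using that seg_antisym[OF assms(1), of x y] by auto
    qed simp
    fix C assume "C \<in> Chains (relation_of (\<lambda>x y. x \<in> seg a y) (topspace X))"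
    then have C: "C \<subseteq> topspace X" "\<And>x y. x \<in> C \<Longrightarrow> y \<in> C \<Longrightarrow> x \<in> seg a y \<or> y \<in> seg a x"
      by (auto simp: Chains_def relation_of_def)
    show "\<exists>u\<in>topspace X. \<forall>x\<in>C. x \<in> seg a u"
    proof (cases "C = {}")
      case True then show ?thesis using assms by auto
    next
      case False
      have "\<Inter>((\<lambda>x. {y \<in> topspace X. x \<in> seg a y}) ` C) \<noteq> {}"
      proof (rule compact_space_chain_Inter_nonempty[OF compact])
        fix A assume "A \<in> (\<lambda>x. {y \<in> topspace X. x \<in> seg a y}) ` C"
        then show "closedin X A \<and> A \<noteq> {}" using closed C by fastforce
      next
        fix A B assume "A \<in> (\<lambda>x. {y \<in> topspace X. x \<in> seg a y}) ` C"
          "B \<in> (\<lambda>x. {y \<in> topspace X. x \<in> seg a y}) ` C"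
        then obtain x x' where "x \<in> C" "x' \<in> C" "A = {y \<in> topspace X. x \<in> seg a y}"
          "B = {y \<in> topspace X. x' \<in> seg a y}" by auto
        then show "A \<subseteq> B \<or> B \<subseteq> A" using C(2)[of x x'] seg_trans by blast
      qed (use False in simp)
      then show ?thesis using False by auto
    qed
  qed
  then obtain e where e: "e \<in> topspace X" "\<And>y. y \<in> topspace X \<Longrightarrow> e \<in> seg a y \<Longrightarrow> y = e" by blast
  \<comment> \<open>The point \<open>a\<close> precedes every point, in particular \<open>b\<close>,
    so it is not maximal.\<close>
  have "e \<noteq> a" using e(2)[of b] assms by auto
  have join: "\<exists>K U. subcontinuum X K \<and> openin X U \<and> a \<in> K \<and> y \<in> U \<and> U \<subseteq> K \<and> e \<notin> K"
    if y: "y \<in> topspace X" "y \<noteq> e" for y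
  proof -
    obtain K where K: "subcontinuum X K" "a \<in> K" "y \<in> K" "e \<notin> K" using e(2) y unfolding mem_seg by blast
    obtain K' U where K': "subcontinuum X K'" "openin X U" "y \<in> U" "U \<subseteq> K'" "e \<notin> K'"
      using subcontinuum_nbhd_avoiding_point[OF y(1) e(1) y(2)] by metis
    have "subcontinuum X (K \<union> K')" using K K' by (intro subcontinuum_Un) auto
    then show ?thesis using K K' by (intro exI[of _ "K \<union> K'"] exI[of _ U]) auto
  qed
  show ?thesis
  proof (rule that[OF e(1)])
    fix V assume V: "openin X V" "e \<in> V"
    define C where "C = topspace X - V"
    have C: "closedin X C" "e \<notin> C" "C \<subseteq> topspace X" using V by (auto simp: C_def)
    have "\<forall>y\<in>C. \<exists>K U. subcontinuum X K \<and> openin X U \<and> a \<in> K \<and> y \<in> U \<and> U \<subseteq> K \<and> e \<notin> K"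
      using join C by (metis subsetD)
    then obtain K U where KU: "\<And>y. y \<in> C \<Longrightarrow> subcontinuum X (K y) \<and> openin X (U y) \<and> a \<in> K y \<and>
      y \<in> U y \<and> U y \<subseteq> K y \<and> e \<notin> K y" by metis
    have "compactin X C" using C compact closedin_compact_space by blast
    then obtain \<F> where F: "finite \<F>" "\<F> \<subseteq> U ` C" "C \<subseteq> \<Union>\<F>"
      using compactinD[of X C "U ` C"] KU by blast
    then obtain D where D: "finite D" "D \<subseteq> C" "C \<subseteq> (\<Union>y\<in>D. U y)"
      using finite_subset_image[OF F(1,2)] by auto
    \<comment> \<open>All members contain \<open>a\<close>, so the union is connected;
      \<open>{a}\<close> keeps it nonempty when \<open>C\<close> and \<open>D\<close> are
      empty.\<close>
    let ?K = "\<Union>(insert {a} (K ` D))"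
    have "connectedin X ?K"
      by (rule connectedin_Union) (use D KU assms in \<open>auto simp: subcontinuum_def\<close>)
    moreover have "closedin X ?K"
      using D KU subcontinuum_singleton[OF assms(1)]
      by (intro closedin_Union) (auto simp: subcontinuum_def)
    ultimately have "subcontinuum X ?K" by (auto simp: subcontinuum_def)
    moreover have "e \<notin> ?K" using KU D \<open>e \<noteq> a\<close> by auto
    moreover have "C \<subseteq> ?K"
    proof
      fix y assume "y \<in> C"
      then obtain d where "d \<in> D" "y \<in> U d" using D by auto
      then have "y \<in> K d" using KU[of d] D by auto
      then show "y \<in> ?K" using \<open>d \<in> D\<close> by auto
    qed
    moreover have "topspace X - ?K \<subseteq> V" "?K \<noteq> topspace X"
      using calculation e(1) unfolding C_def by auto
    ultimately show "\<exists>K. subcontinuum X K \<and> K \<noteq> topspace X \<and> topspace X - K \<subseteq> V"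
      by blast
  qed
qed

end

section \<open>Subcontinua as dendrons, and their ends\<close>

context dendron_space
begin

text \<open>A cut of \<open>X\<close> between two points of \<open>Y\<close> restricts to
  \<open>Y\<close>, for its cut point lies on every connected set through both points.\<close>

lemma dendron_subcontinuum:
  assumes Y: "subcontinuum X Y"
  shows "dendron (subtopology X Y)"
proof -
  have YX: "Y \<subseteq> topspace X" by (rule subcontinuum_subset[OF Y])
  have top: "topspace (subtopology X Y) = Y" using YX by auto
  have "\<exists>w \<in> Y - {u, v}. \<exists>U V. openin (subtopology X Y) U \<and> openin (subtopology X Y) V \<and>
      U \<inter> V = {} \<and> U \<union> V = Y - {w} \<and> u \<in> U \<and> v \<in> V"
    if uv: "u \<in> Y" "v \<in> Y" "u \<noteq> v" for u v
  proof -
    have uvX: "u \<in> topspace X" "v \<in> topspace X" using uv YX by auto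
    obtain w K L where w: "subcontinuum X K" "subcontinuum X L" "K \<union> L = topspace X"
      "K \<inter> L = {w}" "u \<notin> L" "v \<notin> K" "\<And>C. connectedin X C \<Longrightarrow> u \<in> C \<Longrightarrow> v \<in> C \<Longrightarrow> w \<in> C"
      using separation[OF uvX uv(3)] by metis
    have "openin X (topspace X - L)" "openin X (topspace X - K)"
      using w by (auto simp: subcontinuum_def)
    then have "openin (subtopology X Y) (Y \<inter> (topspace X - L))" "openin (subtopology X Y) (Y \<inter> (topspace X - K))"
      by (simp_all add: openin_subtopology_Int2)
    moreover have "w \<in> Y - {u, v}" using w(4-7) Y uv unfolding subcontinuum_def by blast
    moreover have "Y \<inter> (topspace X - L) \<inter> (Y \<inter> (topspace X - K)) = {}"
      "Y \<inter> (topspace X - L) \<union> Y \<inter> (topspace X - K) = Y - {w}"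
      "u \<in> Y \<inter> (topspace X - L)" "v \<in> Y \<inter> (topspace X - K)"
      using w(3-6) uv YX by auto
    ultimately show ?thesis by blast
  qed
  moreover have "compact_space (subtopology X Y)"
    using Y compact closedin_compact_space compact_space_subtopology unfolding subcontinuum_def by blast
  ultimately show ?thesis
    using Y Hausdorff unfolding dendron_def top
    by (simp add: subcontinuum_def connectedin_def Hausdorff_space_subtopology)
qed

lemma ex_end_point_subcontinuum:
  assumes Y: "subcontinuum X Y" and ab: "a \<in> Y" "b \<in> Y" "a \<noteq> b"
  obtains e where "e \<in> Y" "\<And>V. openin X V \<Longrightarrow> e \<in> V \<Longrightarrow>
    \<exists>K. subcontinuum X K \<and> K \<subset> Y \<and> Y - K \<subseteq> V"
proof -
  have YX: "Y \<subseteq> topspace X" by (rule subcontinuum_subset[OF Y])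
  interpret Y: dendron_space "subtopology X Y"
    using dendron_subcontinuum[OF Y] by unfold_locales
  have top: "topspace (subtopology X Y) = Y" using YX by auto
  have sub: "subcontinuum X K \<and> K \<subseteq> Y" if "subcontinuum (subtopology X Y) K" for K
    using that Y unfolding subcontinuum_def
    by (metis closedin_trans_full connectedin_subtopology)
  obtain e where e: "e \<in> Y" "\<And>V. openin (subtopology X Y) V \<Longrightarrow> e \<in> V \<Longrightarrow>
    \<exists>K. subcontinuum (subtopology X Y) K \<and> K \<noteq> Y \<and> Y - K \<subseteq> V"
    using Y.ex_end_point[of a b] ab unfolding top by metis
  show ?thesis
  proof (rule that[OF e(1)])
    fix V assume "openin X V" "e \<in> V"
    then have "openin (subtopology X Y) (Y \<inter> V)" "e \<in> Y \<inter> V"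
      using e(1) by (simp_all add: openin_subtopology_Int2)
    from e(2)[OF this] show "\<exists>K. subcontinuum X K \<and> K \<subset> Y \<and> Y - K \<subseteq> V"
      using sub by blast
  qed
qed

end

section \<open>Actions without finite orbits\<close>

locale dendron_action = dendron_space X for X :: "'a topology" +
  fixes G :: "('g, 'm) monoid_scheme" (structure) and \<phi> :: "'g \<Rightarrow> 'a \<Rightarrow> 'a"
  assumes action: "homeo_action G X \<phi>"
    and infinite_orbit: "x \<in> topspace X \<Longrightarrow> infinite (orbit G \<phi> x)"
begin

sublocale group_action G "topspace X" \<phi>
  using action by (simp add: homeo_action_def)

sublocale group G
  using group_hom by (simp add: group_hom_def)

lemma homeo: "g \<in> carrier G \<Longrightarrow> homeomorphic_map X X (\<phi> g)"
  using action by (simp add: homeo_action_def)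

lemma act_in: "g \<in> carrier G \<Longrightarrow> x \<in> topspace X \<Longrightarrow> \<phi> g x \<in> topspace X"
  using element_image by blast

lemma act_one [simp]: "x \<in> topspace X \<Longrightarrow> \<phi> \<one> x = x"
  by (metis id_eq_one restrict_apply')

lemma act_inv_left [simp]: "g \<in> carrier G \<Longrightarrow> x \<in> topspace X \<Longrightarrow> \<phi> (inv g) (\<phi> g x) = x"
  using orbit_sym_aux by blast

lemma act_inv_right [simp]: "g \<in> carrier G \<Longrightarrow> x \<in> topspace X \<Longrightarrow> \<phi> g (\<phi> (inv g) x) = x"
  using act_inv_left[of "inv g" x] by simp

lemma act_mem_iff:
  assumes "g \<in> carrier G" "x \<in> topspace X" "A \<subseteq> topspace X"
  shows "\<phi> g x \<in> A \<longleftrightarrow> x \<in> \<phi> (inv g) ` A"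
proof
  assume "\<phi> g x \<in> A"
  then have "\<phi> (inv g) (\<phi> g x) \<in> \<phi> (inv g) ` A" by (rule imageI)
  then show "x \<in> \<phi> (inv g) ` A" using assms by simp
next
  assume "x \<in> \<phi> (inv g) ` A"
  then obtain a where "a \<in> A" "x = \<phi> (inv g) a" by blast
  then show "\<phi> g x \<in> A" using assms(1,3) by auto
qed

lemma act_mem_image_iff:
  assumes "g \<in> carrier G" "h \<in> carrier G" "x \<in> topspace X" "A \<subseteq> topspace X"
  shows "\<phi> g x \<in> \<phi> h ` A \<longleftrightarrow> x \<in> \<phi> (inv g \<otimes> h) ` A"
proof -
  have "\<phi> (inv g \<otimes> h) ` A = \<phi> (inv g) ` \<phi> h ` A"
    unfolding image_image using assms composition_rule[of _ "inv g" h] by (intro image_cong) auto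
  moreover have "\<phi> h ` A \<subseteq> topspace X" using assms act_in by auto
  ultimately show ?thesis using act_mem_iff[OF assms(1,3)] by simp
qed

lemma openin_act: "g \<in> carrier G \<Longrightarrow> openin X V \<Longrightarrow> openin X (\<phi> g ` V)"
  using homeo homeomorphic_imp_open_map open_map_def by metis

lemma closedin_act: "g \<in> carrier G \<Longrightarrow> closedin X V \<Longrightarrow> closedin X (\<phi> g ` V)"
  using homeo homeomorphic_imp_closed_map closed_map_def by metis

lemma subcontinuum_act: "g \<in> carrier G \<Longrightarrow> subcontinuum X K \<Longrightarrow> subcontinuum X (\<phi> g ` K)"
  unfolding subcontinuum_def
  by (metis closedin_act closedin_subset homeo homeomorphic_map_connectedness image_is_empty)

section \<open>Closed invariant sets and minimal sets\<close>

lemma closedin_avoiding_orbit: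
  assumes "openin X V"
  shows "closedin X {x \<in> topspace X. \<forall>g\<in>carrier G. \<phi> g x \<notin> V}"
proof -
  have "{x \<in> topspace X. \<forall>g\<in>carrier G. \<phi> g x \<notin> V} = \<Inter>((\<lambda>g. topspace X - \<phi> (inv g) ` V) ` carrier G)"
    using act_mem_iff[OF _ _ openin_subset[OF assms]] by (auto intro: one_closed)
  also have "closedin X \<dots>"
    using openin_act[OF _ assms] by (intro closedin_Inter) auto
  finally show ?thesis .
qed

lemma invariantD: "invariant_set G \<phi> S \<Longrightarrow> g \<in> carrier G \<Longrightarrow> x \<in> S \<Longrightarrow> \<phi> g x \<in> S"
  by (auto simp: invariant_set_def)

lemma invariant_Inter:
  "(\<And>A. A \<in> \<A> \<Longrightarrow> invariant_set G \<phi> A) \<Longrightarrow> invariant_set G \<phi> (\<Inter>\<A>)"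
  unfolding invariant_set_def by blast

lemma invariant_eq:
  assumes "invariant_set G \<phi> S" "S \<subseteq> topspace X" "g \<in> carrier G"
  shows "\<phi> g ` S = S"
proof
  show "\<phi> g ` S \<subseteq> S" using assms by (auto simp: invariant_set_def)
  show "S \<subseteq> \<phi> g ` S"
  proof
    fix x assume "x \<in> S"
    then have "\<phi> (inv g) x \<in> S" "\<phi> g (\<phi> (inv g) x) = x"
      using assms invariantD by auto
    then show "x \<in> \<phi> g ` S" by (metis imageI)
  qed
qed

lemma infinite_invariant:
  assumes "invariant_set G \<phi> S" "S \<subseteq> topspace X" "S \<noteq> {}"
  shows "infinite S"
proof -
  obtain x where x: "x \<in> S" using assms by auto
  then have "orbit G \<phi> x \<subseteq> S" using assms invariantD by (auto simp: orbit_def)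
  then show ?thesis using infinite_orbit[of x] x assms finite_subset by auto
qed

lemma ex_minimal_set:
  assumes "closedin X S" "S \<noteq> {}" "invariant_set G \<phi> S"
  obtains M where "minimal_set G X \<phi> M" "M \<subseteq> S"
proof -
  obtain M where "M \<in> {A. closedin X A \<and> A \<noteq> {} \<and> invariant_set G \<phi> A}" "M \<subseteq> S"
    "\<And>A. A \<in> {A. closedin X A \<and> A \<noteq> {} \<and> invariant_set G \<phi> A} \<Longrightarrow> A \<subseteq> M \<Longrightarrow> A = M"
  proof (rule ex_minimal_closed_set[OF compact, of S])
    show "\<Inter>\<C> \<in> {A. closedin X A \<and> A \<noteq> {} \<and> invariant_set G \<phi> A}"
      if "\<C> \<noteq> {}" "\<C> \<subseteq> {A. closedin X A \<and> A \<noteq> {} \<and> invariant_set G \<phi> A}" "\<Inter>\<C> \<noteq> {}" for \<C>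
      using that by (auto intro!: closedin_Inter invariant_Inter)
  qed (use assms in auto)
  then show ?thesis using that[of M] unfolding minimal_set_def by blast
qed

lemma minimal_setD:
  assumes "minimal_set G X \<phi> M"
  shows "M \<noteq> {}" "closedin X M" "invariant_set G \<phi> M" "M \<subseteq> topspace X"
  using assms closedin_subset by (auto simp: minimal_set_def)

lemma minimal_set_eq:
  assumes "minimal_set G X \<phi> M" "N \<subseteq> M" "N \<noteq> {}" "closedin X N" "invariant_set G \<phi> N"
  shows "N = M"
  using assms unfolding minimal_set_def by blast

text \<open>Otherwise the points of \<open>M\<close> whose orbits avoid \<open>V\<close> form a
  nonempty closed invariant subset, hence all of \<open>M\<close>, although \<open>M\<close> meets
  \<open>V\<close>.\<close>

lemma minimal_set_orbit_meets:
  assumes M: "minimal_set G X \<phi> M" and V: "openin X V" "M \<inter> V \<noteq> {}" and m: "m \<in> M"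
  shows "\<exists>g\<in>carrier G. \<phi> g m \<in> V"
proof (rule ccontr)
  assume con: "\<not> (\<exists>g\<in>carrier G. \<phi> g m \<in> V)"
  define N where "N = M \<inter> {x \<in> topspace X. \<forall>g\<in>carrier G. \<phi> g x \<notin> V}"
  note D = minimal_setD[OF M]
  have "N = M"
  proof (rule minimal_set_eq[OF M])
    show "closedin X N" unfolding N_def by (intro closedin_Int D closedin_avoiding_orbit V)
    show "N \<noteq> {}" using m con D by (auto simp: N_def)
    show "invariant_set G \<phi> N"
      unfolding invariant_set_def N_def
    proof clarify
      fix g x assume g: "g \<in> carrier G" and x: "x \<in> M" "x \<in> topspace X" "\<forall>g\<in>carrier G. \<phi> g x \<notin> V"
      have "\<phi> h (\<phi> g x) \<notin> V" if "h \<in> carrier G" for h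
        using composition_rule[OF x(2) that g] x(3) g that by (metis m_closed)
      then show "\<phi> g x \<in> M \<inter> {x \<in> topspace X. \<forall>g\<in>carrier G. \<phi> g x \<notin> V}"
        using g x act_in invariantD[OF D(3)] by blast
    qed
  qed (auto simp: N_def)
  moreover obtain x where x: "x \<in> M" "x \<in> V" using V by auto
  ultimately have "\<phi> \<one> x \<notin> V" unfolding N_def by blast
  then show False using x D by auto
qed

text \<open>Subcontinua can be pulled back along \<open>g\<close> and \<open>Y\<close> is invariant,
  so the translated gate has the property that characterises the gate of the translated
  point.\<close>

lemma gate_act:
  assumes Y: "subcontinuum X Y" "invariant_set G \<phi> Y" and g: "g \<in> carrier G" and m: "m \<in> topspace X"
  shows "gate Y (\<phi> g m) = \<phi> g (gate Y m)"
proof (rule gate_eqI[OF Y(1)])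
  note YX = subcontinuum_subset[OF Y(1)]
  show "\<phi> g m \<in> topspace X" using act_in g m by blast
  show "\<phi> g (gate Y m) \<in> Y" using invariantD Y g gate_in[OF Y(1) m] by blast
  fix K assume K: "subcontinuum X K" "\<phi> g m \<in> K" "K \<inter> Y \<noteq> {}"
  note KX = subcontinuum_subset[OF K(1)]
  have "subcontinuum X (\<phi> (inv g) ` K)" using K g subcontinuum_act by simp
  moreover have "m \<in> \<phi> (inv g) ` K" using K act_mem_iff[OF g m KX] by simp
  moreover have "\<phi> (inv g) ` K \<inter> Y \<noteq> {}" using K(3) invariantD[OF Y(2), of "inv g"] g by blast
  ultimately have "gate Y m \<in> \<phi> (inv g) ` K" by (rule gate_mem[OF Y(1) m])
  then show "\<phi> g (gate Y m) \<in> K" using act_mem_iff[OF g _ KX] gate_in[OF Y(1) m] YX by blast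
qed

text \<open>If \<open>S\<close> missed \<open>Y\<close>, its finite set of gates would contain a
  whole orbit, by \<open>gate_act\<close>.\<close>

lemma closed_invariant_meets_subcontinuum:
  assumes S: "closedin X S" "S \<noteq> {}" "invariant_set G \<phi> S" and Y: "subcontinuum X Y" "invariant_set G \<phi> Y"
  shows "S \<inter> Y \<noteq> {}"
proof
  assume SY: "S \<inter> Y = {}"
  have SX: "S \<subseteq> topspace X" using S closedin_subset by auto
  obtain m where m: "m \<in> S" using S by auto
  have "orbit G \<phi> (gate Y m) \<subseteq> gate Y ` S"
    using gate_act[OF Y] m SX invariantD[OF S(3)] unfolding orbit_def by force
  moreover have "finite (gate Y ` S)" by (rule finite_gate_image[OF Y(1) S(1) SY])
  moreover have "gate Y m \<in> topspace X"
    using gate_in[OF Y(1)] m SX subcontinuum_subset[OF Y(1)] by blast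
  ultimately show False using infinite_orbit finite_subset by blast
qed

lemma ex_minimal_invariant_subcontinuum:
  obtains Y where "subcontinuum X Y" "invariant_set G \<phi> Y"
    "\<And>K. subcontinuum X K \<Longrightarrow> invariant_set G \<phi> K \<Longrightarrow> K \<subseteq> Y \<Longrightarrow> K = Y"
proof -
  obtain M where "M \<in> {A. subcontinuum X A \<and> invariant_set G \<phi> A}" "M \<subseteq> topspace X"
    "\<And>A. A \<in> {A. subcontinuum X A \<and> invariant_set G \<phi> A} \<Longrightarrow> A \<subseteq> M \<Longrightarrow> A = M"
  proof (rule ex_minimal_closed_set[OF compact, of "topspace X"])
    show "\<Inter>\<C> \<in> {A. subcontinuum X A \<and> invariant_set G \<phi> A}"
      if "\<C> \<noteq> {}" "\<C> \<subseteq> {A. subcontinuum X A \<and> invariant_set G \<phi> A}" "\<Inter>\<C> \<noteq> {}" for \<C>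
      using that by (auto intro!: subcontinuum_Inter invariant_Inter)
    show "topspace X \<in> {A. subcontinuum X A \<and> invariant_set G \<phi> A}"
      using subcontinuum_topspace act_in by (auto simp: invariant_set_def)
  qed (auto simp: subcontinuum_def)
  then show ?thesis using that[of M] by blast
qed

end

section \<open>Translates inside a minimal invariant subcontinuum\<close>

locale dendron_action_core = dendron_action X G \<phi>
  for X :: "'a topology" and G :: "('g, 'm) monoid_scheme" (structure) and \<phi> :: "'g \<Rightarrow> 'a \<Rightarrow> 'a" +
  fixes Y :: "'a set"
  assumes core: "subcontinuum X Y" "invariant_set G \<phi> Y"
    and core_minimal: "\<And>K. subcontinuum X K \<Longrightarrow> invariant_set G \<phi> K \<Longrightarrow> K \<subseteq> Y \<Longrightarrow> K = Y"
begin

lemma core_subset: "Y \<subseteq> topspace X"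
  by (rule subcontinuum_subset[OF core(1)])

lemma core_closed: "closedin X Y"
  using core by (simp add: subcontinuum_def)

lemma minimal_set_subset_core:
  assumes M: "minimal_set G X \<phi> M" shows "M \<subseteq> Y"
proof -
  note D = minimal_setD[OF M]
  have "M \<inter> Y = M"
  proof (rule minimal_set_eq[OF M])
    show "M \<inter> Y \<noteq> {}" by (rule closed_invariant_meets_subcontinuum[OF D(2,1,3) core])
    show "invariant_set G \<phi> (M \<inter> Y)" using invariant_Inter[of "{M, Y}"] D core by auto
  qed (use D core_closed in auto)
  then show ?thesis by blast
qed

lemma ex_disjoint_translate:
  assumes K: "subcontinuum X K" "K \<subset> Y"
  shows "\<exists>g\<in>carrier G. \<phi> g ` K \<inter> K = {}"
proof (rule ccontr)
  assume con: "\<not> ?thesis"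
  let ?F = "(\<lambda>g. \<phi> g ` K) ` carrier G"
  note KX = subcontinuum_subset[OF K(1)]
  have sub: "subcontinuum X A" if "A \<in> ?F" for A using that subcontinuum_act K by auto
  have ne: "\<Inter>?F \<noteq> {}"
  proof (rule Helly)
    fix A B assume "A \<in> ?F" "B \<in> ?F"
    then obtain g h where gh: "g \<in> carrier G" "h \<in> carrier G" "A = \<phi> g ` K" "B = \<phi> h ` K" by auto
    \<comment> \<open>Moving by \<open>inv g\<close> reduces the meeting of two translates to that
      of one translate with \<open>K\<close> itself.\<close>
    then have "\<phi> (inv g \<otimes> h) ` K \<inter> K \<noteq> {}" using con by auto
    then obtain x where x: "x \<in> K" "x \<in> \<phi> (inv g \<otimes> h) ` K" by auto
    then have "\<phi> g x \<in> \<phi> h ` K" using act_mem_image_iff[OF gh(1,2) _ KX] KX by blast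
    then show "A \<inter> B \<noteq> {}" using gh x by auto
  qed (use sub one_closed in auto)
  have subK: "\<Inter>?F \<subseteq> K"
  proof -
    have "\<phi> \<one> ` K = K" using KX by force
    then show ?thesis by (metis INF_lower one_closed)
  qed
  have "\<Inter>?F = Y"
  proof (rule core_minimal)
    show "subcontinuum X (\<Inter>?F)" using sub ne one_closed by (intro subcontinuum_Inter) blast+
    show "\<Inter>?F \<subseteq> Y" using subK K by auto
    show "invariant_set G \<phi> (\<Inter>?F)"
      unfolding invariant_set_def
    proof clarsimp
      fix g x h assume g: "g \<in> carrier G" "h \<in> carrier G" and x: "\<forall>g\<in>carrier G. x \<in> \<phi> g ` K"
      have "x \<in> topspace X" using x one_closed KX act_in by (metis imageE subsetD)
      moreover have "x \<in> \<phi> (inv g \<otimes> h) ` K" using x g by auto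
      ultimately show "\<phi> g x \<in> \<phi> h ` K" using act_mem_image_iff[OF g _ KX] by blast
    qed
  qed
  then show False using subK K by auto
qed

text \<open>Both \<open>K\<close> and \<open>L\<close> have translates disjoint from themselves. If
  every translate of \<open>K\<close> met \<open>L\<close>, each would also meet the translate of
  \<open>L\<close>; then \<open>L\<close> and its translate would be disjoint and both join
  \<open>K\<close> to its own disjoint translate, against
  \<open>subcontinua_crossing\<close>.\<close>

lemma ex_translate_avoiding:
  assumes K: "subcontinuum X K" "K \<subset> Y" and L: "subcontinuum X L" "L \<subset> Y"
  shows "\<exists>g\<in>carrier G. \<phi> g ` K \<inter> L = {}"
proof (rule ccontr)
  assume con: "\<not> ?thesis"
  then have meet: "\<phi> g ` K \<inter> L \<noteq> {}" if "g \<in> carrier G" for g using that by auto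
  note KX = subcontinuum_subset[OF K(1)]
  note LX = subcontinuum_subset[OF L(1)]
  obtain k where k: "k \<in> carrier G" "\<phi> k ` K \<inter> K = {}" using ex_disjoint_translate[OF K] by auto
  obtain h where h: "h \<in> carrier G" "\<phi> h ` L \<inter> L = {}" using ex_disjoint_translate[OF L] by auto
  have meet2: "\<phi> h ` L \<inter> \<phi> g ` K \<noteq> {}" if g: "g \<in> carrier G" for g
  proof -
    obtain x where x: "x \<in> L" "x \<in> \<phi> (inv h \<otimes> g) ` K" using meet[of "inv h \<otimes> g"] g h by auto
    then have "\<phi> h x \<in> \<phi> g ` K" using act_mem_image_iff[OF h(1) g _ KX] LX by blast
    then show ?thesis using x by auto
  qed
  have one: "\<phi> \<one> ` K = K" using KX by force
  have "L \<inter> \<phi> h ` L \<noteq> {}"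
  proof (rule subcontinua_crossing)
    show "subcontinuum X K" "subcontinuum X L" "subcontinuum X (\<phi> k ` K)" "subcontinuum X (\<phi> h ` L)"
      using K L k h subcontinuum_act by auto
    show "K \<inter> \<phi> k ` K = {}" using k by auto
    show "L \<inter> K \<noteq> {}" "L \<inter> \<phi> k ` K \<noteq> {}" using meet[OF one_closed] meet[OF k(1)] one by auto
    show "\<phi> h ` L \<inter> K \<noteq> {}" "\<phi> h ` L \<inter> \<phi> k ` K \<noteq> {}"
      using meet2[OF one_closed] meet2[OF k(1)] one by auto
  qed
  then show False using h by auto
qed

section \<open>Ends of \<open>Y\<close> and the minimal set\<close>

text \<open>Complements of subcontinua are the convenient neighbourhoods here: whatever is moved
  within \<open>Y\<close> off \<open>K\<close> lands in \<open>V\<close>.\<close>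

definition core_end :: "'a \<Rightarrow> bool" where
  "core_end e \<longleftrightarrow> e \<in> Y \<and> (\<forall>V. openin X V \<longrightarrow> e \<in> V \<longrightarrow>
    (\<exists>K. subcontinuum X K \<and> K \<subset> Y \<and> Y - K \<subseteq> V))"

lemma ex_core_end: "\<exists>e. core_end e"
proof -
  have inf: "infinite Y" using infinite_invariant[OF core(2) core_subset] core by (auto simp: subcontinuum_def)
  then obtain a where a: "a \<in> Y" by fastforce
  have "Y - {a} \<noteq> {}" using inf by (metis finite.emptyI infinite_remove)
  then obtain b where b: "b \<in> Y" "a \<noteq> b" by blast
  show ?thesis
    using ex_end_point_subcontinuum[OF core(1) a b] unfolding core_end_def by metis
qed

lemma core_end_act:
  assumes e: "core_end e" and g: "g \<in> carrier G" shows "core_end (\<phi> g e)"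
  unfolding core_end_def
proof (intro conjI allI impI)
  have eY: "e \<in> Y" "e \<in> topspace X" using e core_subset by (auto simp: core_end_def)
  then show "\<phi> g e \<in> Y" using invariantD[OF core(2)] g by blast
  fix V assume V: "openin X V" "\<phi> g e \<in> V"
  note VX = openin_subset[OF V(1)]
  have "openin X (\<phi> (inv g) ` V)" "e \<in> \<phi> (inv g) ` V"
    using V g openin_act act_mem_iff[OF g eY(2) VX] by auto
  then obtain K where K: "subcontinuum X K" "K \<subset> Y" "Y - K \<subseteq> \<phi> (inv g) ` V"
    using e unfolding core_end_def by metis
  have gY: "\<phi> g ` Y = Y" by (rule invariant_eq[OF core(2) core_subset g])
  have inj: "inj_on (\<phi> g) Y" using inj_prop[OF g] core_subset inj_on_subset by blast
  have KY: "K \<subseteq> Y" "K \<noteq> Y" using K by auto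
  have "\<phi> g ` K \<noteq> \<phi> g ` Y" using inj_on_image_eq_iff[OF inj KY(1)] KY(2) by simp
  then have "\<phi> g ` K \<subset> Y" using image_mono[OF KY(1), of "\<phi> g"] unfolding gY by blast
  moreover have "Y - \<phi> g ` K = \<phi> g ` (Y - K)"
    using inj_on_image_set_diff[OF inj Diff_subset KY(1)] unfolding gY by simp
  moreover have "\<phi> g ` (Y - K) \<subseteq> V"
  proof clarify
    fix x assume "x \<in> Y" "x \<notin> K"
    then show "\<phi> g x \<in> V" using K act_mem_iff[OF g _ VX] core_subset by blast
  qed
  ultimately show "\<exists>K. subcontinuum X K \<and> K \<subset> Y \<and> Y - K \<subseteq> V"
    using K subcontinuum_act[OF g] by metis
qed

text \<open>If \<open>e\<close> were outside \<open>M\<close>, a proper subcontinuum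
  \<open>K\<close> would contain \<open>M\<close>, and so would a translate of \<open>K\<close>
  disjoint from \<open>K\<close>.\<close>

lemma core_end_in_minimal_set:
  assumes M: "minimal_set G X \<phi> M" and e: "core_end e"
  shows "e \<in> M"
proof (rule ccontr)
  assume "e \<notin> M"
  note D = minimal_setD[OF M]
  have "e \<in> topspace X - M" "openin X (topspace X - M)"
    using e core_subset D \<open>e \<notin> M\<close> by (auto simp: core_end_def)
  then obtain K where K: "subcontinuum X K" "K \<subset> Y" "Y - K \<subseteq> topspace X - M"
    using e unfolding core_end_def by metis
  then have MK: "M \<subseteq> K" using minimal_set_subset_core[OF M] by blast
  obtain g where g: "g \<in> carrier G" "\<phi> g ` K \<inter> K = {}" using ex_disjoint_translate[OF K(1,2)] by auto
  have "\<phi> g ` M \<subseteq> K \<inter> \<phi> g ` K" using MK invariant_eq[OF D(3,4) g(1)] by blast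
  then show False using g D(1) by blast
qed

text \<open>The orbit of an end enters every neighbourhood \<open>V\<close> of \<open>q\<close> by
  minimality. Translates of ends are ends, and the subcontinuum found for the translate in
  \<open>V\<close> also serves \<open>q\<close>.\<close>

lemma minimal_set_core_end:
  assumes M: "minimal_set G X \<phi> M" and q: "q \<in> M"
  shows "core_end q"
  unfolding core_end_def
proof (intro conjI allI impI)
  show "q \<in> Y" using minimal_set_subset_core[OF M] q by auto
  fix V assume V: "openin X V" "q \<in> V"
  obtain e where e: "core_end e" using ex_core_end by auto
  then have "e \<in> M" by (rule core_end_in_minimal_set[OF M])
  then obtain g where g: "g \<in> carrier G" "\<phi> g e \<in> V"
    using minimal_set_orbit_meets[OF M V(1)] V q by blast
  then show "\<exists>K. subcontinuum X K \<and> K \<subset> Y \<and> Y - K \<subseteq> V"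
    using core_end_act[OF e g(1)] V unfolding core_end_def by blast
qed

lemma minimal_set_iff_core_ends:
  "minimal_set G X \<phi> M \<longleftrightarrow> M = {e. core_end e}"
proof -
  have *: "N = {e. core_end e}" if "minimal_set G X \<phi> N" for N
    using core_end_in_minimal_set minimal_set_core_end that by blast
  obtain N where "minimal_set G X \<phi> N" using ex_minimal_set[OF core_closed _ core(2)] core(1)
    by (auto simp: subcontinuum_def)
  then show ?thesis using * by metis
qed

text \<open>An end \<open>q\<close> of \<open>Y\<close> outside \<open>A\<close> confines
  \<open>A \<inter> Y\<close> to a proper subcontinuum \<open>K\<close>; an end \<open>p\<close> in
  \<open>V\<close> gives a proper \<open>L\<close> with \<open>Y - L\<close> inside
  \<open>V\<close>. Moving \<open>K\<close> off \<open>L\<close> does the rest.\<close>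

lemma contraction:
  assumes M: "minimal_set G X \<phi> M" and A: "closedin X A" "\<not> M \<subseteq> A"
    and V: "openin X V" "M \<inter> V \<noteq> {}"
  shows "\<exists>g\<in>carrier G. \<phi> g ` (A \<inter> Y) \<subseteq> V"
proof -
  obtain q where q: "q \<in> M" "q \<notin> A" using A by auto
  have "openin X (topspace X - A)" "q \<in> topspace X - A" using q A minimal_setD[OF M] by auto
  then obtain K where K: "subcontinuum X K" "K \<subset> Y" "Y - K \<subseteq> topspace X - A"
    using minimal_set_core_end[OF M q(1)] unfolding core_end_def by metis
  obtain p where p: "p \<in> M" "p \<in> V" using V by auto
  then obtain L where L: "subcontinuum X L" "L \<subset> Y" "Y - L \<subseteq> V"
    using minimal_set_core_end[OF M p(1)] V unfolding core_end_def by metis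
  obtain g where g: "g \<in> carrier G" "\<phi> g ` K \<inter> L = {}"
    using ex_translate_avoiding[OF K(1,2) L(1,2)] by auto
  have "\<phi> g ` (A \<inter> Y) \<subseteq> V"
  proof clarify
    fix x assume x: "x \<in> A" "x \<in> Y"
    then have "x \<in> K" using K by auto
    then have "\<phi> g x \<in> Y - L" using g invariantD[OF core(2) g(1)] x by blast
    then show "\<phi> g x \<in> V" using L by auto
  qed
  then show ?thesis using g by auto
qed

end

section \<open>Extreme proximality on the minimal set\<close>

lemma homeo_action_restrict:
  assumes act: "homeo_action G X \<phi>" and S: "S \<subseteq> topspace X"
    and inv: "\<And>g. g \<in> carrier G \<Longrightarrow> \<phi> g ` S = S"
  shows "homeo_action G (subtopology X S) (restrict_action \<phi> S)"
proof -
  interpret group_action G "topspace X" \<phi> using act by (simp add: homeo_action_def)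
  interpret group G using group_hom by (simp add: group_hom_def)
  have top: "topspace (subtopology X S) = S" using S by auto
  have bij: "restrict (\<phi> g) S \<in> Bij S" if g: "g \<in> carrier G" for g
  proof -
    have "inj_on (\<phi> g) S" using inj_prop[OF g] S inj_on_subset by blast
    then show ?thesis using inv[OF g] by (simp add: Bij_def bij_betw_def)
  qed
  have "group_action G S (restrict_action \<phi> S)"
  proof (intro group_action.intro group_hom.intro group_hom_axioms.intro homI)
    show "group G" by (rule is_group)
    show "group (BijGroup S)" by (rule group_BijGroup)
    show "restrict_action \<phi> S g \<in> carrier (BijGroup S)" if "g \<in> carrier G" for g
      using bij[OF that] by (simp add: BijGroup_def restrict_action_def)
    fix g h assume gh: "g \<in> carrier G" "h \<in> carrier G"
    have "restrict (\<phi> (g \<otimes>\<^bsub>G\<^esub> h)) S = compose S (restrict (\<phi> g) S) (restrict (\<phi> h) S)"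
    proof
      fix x show "restrict (\<phi> (g \<otimes>\<^bsub>G\<^esub> h)) S x = compose S (restrict (\<phi> g) S) (restrict (\<phi> h) S) x"
        using composition_rule[of x g h] gh inv[OF gh(2)] S by (auto simp: compose_def)
    qed
    then show "restrict_action \<phi> S (g \<otimes>\<^bsub>G\<^esub> h) =
        restrict_action \<phi> S g \<otimes>\<^bsub>BijGroup S\<^esub> restrict_action \<phi> S h"
      using bij gh by (simp add: BijGroup_def restrict_action_def)
  qed
  moreover have "homeomorphic_map (subtopology X S) (subtopology X S) (restrict_action \<phi> S g)"
    if g: "g \<in> carrier G" for g
  proof (rule homeomorphic_map_eq)
    show "homeomorphic_map (subtopology X S) (subtopology X S) (\<phi> g)"
      using act g inv[OF g] S
      by (intro homeomorphic_map_subtopologies) (auto simp: homeo_action_def inf.absorb2)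
  qed (use top in \<open>simp add: restrict_action_def\<close>)
  ultimately show ?thesis unfolding homeo_action_def top by blast
qed

context dendron_action_core
begin

lemma closed_invariant_contains_minimal_set:
  assumes M: "minimal_set G X \<phi> M" and S: "closedin X S" "S \<noteq> {}" "invariant_set G \<phi> S"
  shows "M \<subseteq> S"
  using ex_minimal_set[OF S] M minimal_set_iff_core_ends by metis

lemma extremely_proximal_minimal_set:
  assumes M: "minimal_set G X \<phi> M"
  shows "extremely_proximal G (subtopology X M) (restrict_action \<phi> M)"
proof -
  note D = minimal_setD[OF M]
  have top: "topspace (subtopology X M) = M" using D by auto
  have inv: "\<phi> g ` M = M" if "g \<in> carrier G" for g using invariant_eq[OF D(3,4) that] .
  have cl: "closedin (subtopology X M) A \<longleftrightarrow> closedin X A \<and> A \<subseteq> M" for A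
    using closedin_closed_subtopology[OF D(2)] by simp
  have inv_iff: "invariant_set G (restrict_action \<phi> M) A \<longleftrightarrow> invariant_set G \<phi> A" if "A \<subseteq> M" for A
    using that by (auto simp: invariant_set_def restrict_action_def subset_iff)
  have "minimal_set G (subtopology X M) (restrict_action \<phi> M) M"
    using M inv_iff unfolding minimal_set_def cl by blast
  moreover have "\<exists>g\<in>carrier G. restrict_action \<phi> M g ` A \<subseteq> U"
    if A: "closedin (subtopology X M) A" "A \<subset> M" and U: "openin (subtopology X M) U" "U \<noteq> {}" for A U
  proof -
    obtain V where V: "openin X V" "U = V \<inter> M" using U by (auto simp: openin_subtopology)
    have AY: "A \<subseteq> M" "A \<inter> Y = A" using A minimal_set_subset_core[OF M] by auto
    have "\<exists>g\<in>carrier G. \<phi> g ` (A \<inter> Y) \<subseteq> V"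
      by (rule contraction[OF M _ _ V(1)]) (use A cl V U in auto)
    then obtain g where g: "g \<in> carrier G" "\<phi> g ` A \<subseteq> V" using AY by auto
    then have "restrict_action \<phi> M g ` A \<subseteq> U"
      using inv[OF g(1)] AY V by (auto simp: restrict_action_def)
    then show ?thesis using g by blast
  qed
  ultimately show ?thesis
    using homeo_action_restrict[OF action D(4) inv] infinite_invariant[OF D(3,4,1)]
    unfolding extremely_proximal_def top by blast
qed

section \<open>Proximality on the whole space\<close>

text \<open>The pairs that no element sends into \<open>V \<times> V\<close> form a closed invariant
  set \<open>Z\<close>. If it is nonempty, two projections produce a pair of \<open>Z\<close> inside
  \<open>M\<close>, and \<open>contraction\<close> for these two points gives a
  contradiction.\<close>

lemma ex_simultaneous_contraction:
  assumes M: "minimal_set G X \<phi> M" and V: "openin X V" "M \<inter> V \<noteq> {}"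
    and xy: "x \<in> topspace X" "y \<in> topspace X"
  shows "\<exists>g\<in>carrier G. \<phi> g x \<in> V \<and> \<phi> g y \<in> V"
proof (rule ccontr)
  assume con: "\<not> ?thesis"
  note D = minimal_setD[OF M]
  note VX = openin_subset[OF V(1)]
  define Z where "Z = topspace X \<times> topspace X - (\<Union>g\<in>carrier G. \<phi> (inv g) ` V \<times> \<phi> (inv g) ` V)"
  have Z_iff: "(a, b) \<in> Z \<longleftrightarrow> a \<in> topspace X \<and> b \<in> topspace X \<and>
      (\<forall>g\<in>carrier G. \<not> (\<phi> g a \<in> V \<and> \<phi> g b \<in> V))" for a b
    unfolding Z_def using act_mem_iff[OF _ _ VX] by auto
  have Z_inv: "(\<phi> g a, \<phi> g b) \<in> Z" if "(a, b) \<in> Z" "g \<in> carrier G" for a b g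
  proof -
    have "a \<in> topspace X" "b \<in> topspace X" using that Z_iff by auto
    then show ?thesis
      using that act_in unfolding Z_iff by (metis composition_rule m_closed)
  qed
  have clZ: "closedin (prod_topology X X) Z"
  proof -
    have "openin (prod_topology X X) (\<Union>g\<in>carrier G. \<phi> (inv g) ` V \<times> \<phi> (inv g) ` V)"
      using openin_act V by (intro openin_Union) (auto simp: openin_prod_Times_iff)
    then have "closedin (prod_topology X X)
        (topspace (prod_topology X X) - (\<Union>g\<in>carrier G. \<phi> (inv g) ` V \<times> \<phi> (inv g) ` V))" by blast
    then show ?thesis by (simp add: Z_def)
  qed
  have "(x, y) \<in> Z" using con xy Z_iff by auto
  have "M \<subseteq> fst ` Z"
  proof (rule closed_invariant_contains_minimal_set[OF M])
    show "closedin X (fst ` Z)"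
      using closed_map_fst[OF compact, of X] clZ by (simp add: closed_map_def)
    show "fst ` Z \<noteq> {}" using \<open>(x, y) \<in> Z\<close> by auto
    show "invariant_set G \<phi> (fst ` Z)" using Z_inv by (force simp: invariant_set_def)
  qed
  \<comment> \<open>Keeping the first coordinate in \<open>M\<close> lets the second projection
    supply a pair with both coordinates in \<open>M\<close>.\<close>
  define W where "W = Z \<inter> (M \<times> topspace X)"
  have clW: "closedin (prod_topology X X) W"
    unfolding W_def using clZ D by (intro closedin_Int) (auto simp: closedin_prod_Times_iff)
  have "M \<subseteq> snd ` W"
  proof (rule closed_invariant_contains_minimal_set[OF M])
    show "closedin X (snd ` W)"
      using closed_map_snd[OF compact, of X] clW by (simp add: closed_map_def)
    show "snd ` W \<noteq> {}" using \<open>M \<subseteq> fst ` Z\<close> D Z_iff unfolding W_def by force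
    show "invariant_set G \<phi> (snd ` W)"
      using Z_inv act_in invariantD[OF D(3)] by (force simp: invariant_set_def W_def)
  qed
  then obtain a b where ab: "a \<in> M" "b \<in> M" "(a, b) \<in> Z" using D unfolding W_def by force
  have abX: "{a, b} \<subseteq> Y" "{a, b} \<subseteq> topspace X" using ab minimal_set_subset_core[OF M] core_subset by auto
  have "closedin X {a, b}" using closedin_t1_singleton[OF t1] abX closedin_Un[of X "{a}" "{b}"]
    by (simp add: insert_commute)
  moreover have "\<not> M \<subseteq> {a, b}" using infinite_invariant[OF D(3,4,1)] finite_subset by blast
  ultimately obtain g where "g \<in> carrier G" "\<phi> g ` ({a, b} \<inter> Y) \<subseteq> V"
    using contraction[OF M _ _ V] by blast
  then show False using ab(3) abX(1) Z_iff by auto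
qed

lemma proximal: "proximal_action G X \<phi>"
  unfolding proximal_action_def proximal_pair_def
proof (intro ballI)
  fix x y assume xy: "x \<in> topspace X" "y \<in> topspace X"
  obtain M where M: "minimal_set G X \<phi> M"
    using minimal_set_iff_core_ends by blast
  then obtain z where z: "z \<in> M" "z \<in> topspace X" using minimal_setD by blast
  let ?B = "{V. openin X V \<and> z \<in> V}"
  let ?E = "\<lambda>V. {g \<in> carrier G. \<phi> g x \<in> V \<and> \<phi> g y \<in> V}"
  \<comment> \<open>A filter of group elements that push both points towards \<open>z\<close>; it is
    proper by \<open>ex_simultaneous_contraction\<close>, as every neighbourhood of \<open>z\<close>
    meets \<open>M\<close>.\<close>
  define F where "F = (INF V\<in>?B. principal (?E V))"
  have ev: "eventually P F \<longleftrightarrow> (\<exists>V\<in>?B. \<forall>g\<in>?E V. P g)" for P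
    unfolding F_def
  proof (subst eventually_INF_base)
    show "?B \<noteq> {}" using z by auto
    fix U V assume "U \<in> ?B" "V \<in> ?B"
    then show "\<exists>W\<in>?B. principal (?E W) \<le> inf (principal (?E U)) (principal (?E V))"
      by (intro bexI[of _ "U \<inter> V"]) auto
  qed (simp add: eventually_principal)
  have "F \<noteq> bot"
    unfolding trivial_limit_def ev using ex_simultaneous_contraction[OF M _ _ xy] z by blast
  moreover have "F \<le> principal (carrier G)"
    unfolding le_principal ev using z by blast
  moreover have "limitin X (\<lambda>g. \<phi> g x) z F" "limitin X (\<lambda>g. \<phi> g y) z F"
    unfolding limitin_def ev using z by blast+
  ultimately show "\<exists>F z. F \<noteq> bot \<and> F \<le> principal (carrier G) \<and> z \<in> topspace X \<and>
        limitin X (\<lambda>g. \<phi> g x) z F \<and> limitin X (\<lambda>g. \<phi> g y) z F"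
    using z by blast
qed

end

section \<open>Arcs and branch points\<close>

lemma ex_countable_bump_functions:
  assumes X: "metrizable_space X" "compact_space X"
  obtains h :: "nat \<Rightarrow> 'a \<Rightarrow> real" where
    "\<And>n. continuous_map X euclideanreal (h n)" "\<And>n x. h n x \<in> {0..1}"
    "\<And>S y. closedin X S \<Longrightarrow> y \<in> topspace X \<Longrightarrow> y \<notin> S \<Longrightarrow> \<exists>n. h n y > 0 \<and> (\<forall>z\<in>S. h n z = 0)"
proof -
  obtain M d where "Metric_space M d" and Xeq: "X = Metric_space.mtopology M d"
    using X by (auto simp: metrizable_space_def)
  then interpret Metric_space M d by simp
  have top: "topspace X = M" by (simp add: Xeq)
  have "mtotally_bounded M"
    using X(2) unfolding Xeq by (metis compactin_imp_mtotally_bounded compact_space_def topspace_mtopology)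
  then have "\<forall>k. \<exists>K. finite K \<and> K \<subseteq> M \<and> M \<subseteq> (\<Union>x\<in>K. mball x (1 / real (Suc k)))"
    unfolding mtotally_bounded_def by simp
  then obtain N where N: "\<And>k. finite (N k)" "\<And>k. N k \<subseteq> M" "\<And>k. M \<subseteq> (\<Union>x\<in>N k. mball x (1 / real (Suc k)))"
    by metis
  \<comment> \<open>Truncated cones around net points: \<open>b (q, k)\<close> is positive exactly
    within distance \<open>2 / real (Suc k)\<close> of \<open>q\<close>.\<close>
  define b :: "'a \<times> nat \<Rightarrow> 'a \<Rightarrow> real" where
    "b = (\<lambda>(q, k) z. min 1 (max 0 (2 / real (Suc k) - d q z)))"
  have b_cont: "continuous_map X euclideanreal (b (q, k))" if "q \<in> M" for q k
  proof -
    have "continuous_map X euclideanreal (\<lambda>z. d q z)"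
      unfolding Xeq mtopology_is_euclidean[symmetric]
      unfolding metric_continuous_map[OF Met_TC.Metric_space_axioms]
    proof (intro conjI ballI allI impI)
      fix a and \<epsilon> :: real assume "a \<in> M" "0 < \<epsilon>"
      have "dist (d q a) (d q x) < \<epsilon>" if "x \<in> M \<and> d a x < \<epsilon>" for x
        using triangle[of q a x] triangle[of q x a] that \<open>q \<in> M\<close> \<open>a \<in> M\<close>
        by (auto simp: dist_real_def commute)
      then show "\<exists>\<delta>>0. \<forall>x. x \<in> M \<and> d a x < \<delta> \<longrightarrow> dist (d q a) (d q x) < \<epsilon>"
        using \<open>0 < \<epsilon>\<close> by blast
    qed simp
    then show ?thesis unfolding b_def by (auto intro!: continuous_intros)
  qed
  \<comment> \<open>The dummy index keeps \<open>I\<close> nonempty even if all nets are empty;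
    indices with centre outside \<open>M\<close> receive the zero function.\<close>
  define I where "I = insert (undefined, 0) (SIGMA q:(\<Union>k. N k). (UNIV :: nat set))"
  define h where "h = (\<lambda>n. let i = from_nat_into I n in if fst i \<in> M then b i else (\<lambda>z. 0))"
  have "countable I" unfolding I_def using N(1) by (auto intro: countable_finite)
  have "I \<noteq> {}" by (simp add: I_def)
  show ?thesis
  proof
    fix n
    obtain q k where qk: "from_nat_into I n = (q, k)" by fastforce
    show "continuous_map X euclideanreal (h n)"
      using b_cont[of q k] by (simp add: h_def qk)
    show "h n x \<in> {0..1}" for x by (simp add: h_def qk b_def)
  next
    fix S y assume S: "closedin X S" and y: "y \<in> topspace X" "y \<notin> S"
    have "openin X (topspace X - S)" "y \<in> topspace X - S" using S y by auto
    then obtain r where r: "r > 0" "mball y r \<subseteq> topspace X - S"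
      unfolding Xeq openin_mtopology by blast
    \<comment> \<open>A net point within \<open>1 / real (Suc k)\<close> of \<open>y\<close> carries
      a bump of radius \<open>2 / real (Suc k)\<close>, which therefore stays within
      \<open>r\<close> of \<open>y\<close>.\<close>
    obtain k where "3 / r < real k" using reals_Archimedean2 by blast
    then have k: "3 / real (Suc k) < r" using r(1) by (simp add: field_simps)
    obtain q where q: "q \<in> N k" "y \<in> mball q (1 / real (Suc k))" using N(3)[of k] y top by blast
    then have q: "q \<in> N k" "d q y < 1 / real (Suc k)" by (simp_all add: in_mball)
    have "q \<in> M" using q N by auto
    have "(q, k) \<in> I" using q by (auto simp: I_def)
    then obtain n where n: "from_nat_into I n = (q, k)"
      using from_nat_into_surj[OF \<open>countable I\<close>] by blast
    have hn: "h n = b (q, k)" using \<open>q \<in> M\<close> by (simp add: h_def n)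
    have "h n y > 0"
    proof -
      have "2 / real (Suc k) - d q y > 0" using q(2) by (simp add: field_simps)
      then show ?thesis by (simp add: hn b_def)
    qed
    moreover have "h n z = 0" if "z \<in> S" for z
    proof -
      have z: "z \<in> M" "z \<notin> mball y r" using that S closedin_subset r top by blast+
      then have "r \<le> d y z" using y top by auto
      also have "d y z \<le> d q y + d q z" using triangle[of y q z] y z top \<open>q \<in> M\<close> by (simp add: commute)
      finally have "2 / real (Suc k) \<le> d q z"
        using q(2) k unfolding divide_inverse by linarith
      then show ?thesis by (simp add: hn b_def)
    qed
    ultimately show "\<exists>n. h n y > 0 \<and> (\<forall>z\<in>S. h n z = 0)" by blast
  qed
qed

section \<open>A function strictly increasing along segments\<close>

context dendron_space
begin

lemma seg_subset_Un:
  assumes "a \<in> topspace X" "x \<in> topspace X" "y \<in> topspace X"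
  shows "seg a y \<subseteq> seg a x \<union> seg x y"
proof (rule seg_subset)
  have "x \<in> seg a x \<inter> seg x y" by simp
  then show "subcontinuum X (seg a x \<union> seg x y)"
    using assms by (intro subcontinuum_Un subcontinuum_seg) blast+
qed auto

text \<open>Within a small subcontinuum \<open>N\<close> around \<open>x\<close>, segments from
  \<open>a\<close> to different points of \<open>N\<close> differ only inside \<open>N\<close>.
  There \<open>h\<close> is close to \<open>h x\<close>, so the suprema differ little.\<close>

lemma continuous_map_SUP_seg:
  fixes h :: "'a \<Rightarrow> real"
  assumes h: "continuous_map X euclideanreal h" "\<And>x. h x \<in> {0..1}" and a: "a \<in> topspace X"
  shows "continuous_map X euclideanreal (\<lambda>x. SUP z\<in>seg a x. h z)"
proof -
  have bdd: "bdd_above (h ` A)" for A using h(2) by (intro bdd_aboveI[of _ 1]) auto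
  let ?S = "\<lambda>x. SUP z\<in>seg a x. h z"
  have *: "\<exists>U. openin X U \<and> x \<in> U \<and> (\<forall>y\<in>U. dist (?S x) (?S y) < \<epsilon>)"
    if x: "x \<in> topspace X" and e: "\<epsilon> > 0" for x \<epsilon>
  proof -
    define V where "V = {y \<in> topspace X. h y \<in> ball (h x) (\<epsilon> / 3)}"
    have "openin X V" unfolding V_def using h(1) by (rule openin_continuous_map_preimage) simp
    moreover have "x \<in> V" using x e by (simp add: V_def)
    ultimately obtain N U where N: "subcontinuum X N" "openin X U" "x \<in> U" "U \<subseteq> N" "N \<subseteq> V"
      using subcontinuum_nbhd by metis
    have near: "\<bar>h z - h x\<bar> < \<epsilon> / 3" if "z \<in> N" for z
    proof -
      have "z \<in> V" using N that by blast
      then show ?thesis by (simp add: V_def dist_real_def abs_minus_commute)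
    qed
    have le: "?S v \<le> max (?S u) (h x + \<epsilon> / 3)" if "u \<in> N" "v \<in> N" for u v
    proof (rule cSUP_least)
      show "seg a v \<noteq> {}" using seg_left by blast
      have uvX: "u \<in> topspace X" "v \<in> topspace X" using that subcontinuum_subset[OF N(1)] by auto
      fix z assume "z \<in> seg a v"
      then consider "z \<in> seg a u" | "z \<in> seg u v" using seg_subset_Un[OF a uvX] by blast
      then show "h z \<le> max (?S u) (h x + \<epsilon> / 3)"
      proof cases
        case 1
        then have "h z \<le> ?S u" by (intro cSUP_upper bdd)
        then show ?thesis by simp
      next
        case 2
        then have "z \<in> N" using seg_subset[OF N(1)] that by blast
        then have "h z \<le> h x + \<epsilon> / 3" using near[of z] by linarith
        then show ?thesis by (rule max.coboundedI2)
      qed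
    qed
    have ge: "h y \<le> ?S y" for y by (intro cSUP_upper bdd) simp
    have "dist (?S x) (?S y) < \<epsilon>" if "y \<in> U" for y
    proof -
      have yN: "x \<in> N" "y \<in> N" using N that by auto
      have "h x < h y + \<epsilon> / 3" using near[OF yN(2)] by linarith
      then show ?thesis
        using le[OF yN] le[OF yN(2,1)] ge[of x] ge[of y] e unfolding dist_real_def by linarith
    qed
    then show ?thesis using N by blast
  qed
  show ?thesis
    unfolding mtopology_is_euclidean[symmetric] Met_TC.continuous_map_to_metric
    using * by simp
qed

text \<open>The running supremum along segments from \<open>a\<close> turns bump functions into monotone functions.\<close>

lemma ex_strictly_monotone_map:
  assumes X: "metrizable_space X" and a: "a \<in> topspace X"
  obtains F :: "'a \<Rightarrow> real" where "continuous_map X euclideanreal F"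
    "\<And>x y. x \<in> topspace X \<Longrightarrow> y \<in> topspace X \<Longrightarrow> x \<in> seg a y \<Longrightarrow> x \<noteq> y \<Longrightarrow> F x < F y"
proof -
  obtain h :: "nat \<Rightarrow> 'a \<Rightarrow> real" where
    h: "\<And>n. continuous_map X euclideanreal (h n)" "\<And>n x. h n x \<in> {0..1}"
    "\<And>S y. closedin X S \<Longrightarrow> y \<in> topspace X \<Longrightarrow> y \<notin> S \<Longrightarrow> \<exists>n. h n y > 0 \<and> (\<forall>z\<in>S. h n z = 0)"
    using ex_countable_bump_functions[OF X compact] by metis
  define s where "s = (\<lambda>n x. SUP z\<in>seg a x. h n z)"
  have bdd: "bdd_above (h n ` A)" for n A using h(2) by (intro bdd_aboveI[of _ 1]) auto
  have ne: "seg a x \<noteq> {}" for x using seg_left by blast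
  have s_le: "s n x \<le> 1" for n x unfolding s_def using h(2) ne by (intro cSUP_least) auto
  have s_upper: "h n z \<le> s n x" if "z \<in> seg a x" for n x z
    unfolding s_def using that by (intro cSUP_upper bdd)
  have s_ge: "0 \<le> s n x" for n x using s_upper[of x x n] h(2)[of n x] by auto
  have s_mono: "s n x \<le> s n y" if "x \<in> seg a y" for n x y
    unfolding s_def by (rule cSUP_subset_mono) (use ne bdd seg_trans[OF that] in auto)
  \<comment> \<open>The weights make the series converge uniformly, so that the sum is
    continuous.\<close>
  define f where "f = (\<lambda>n x. (1/2)^n * s n x)"
  define F where "F = (\<lambda>x. \<Sum>n. f n x)"
  have f_norm: "norm (f n x) \<le> (1/2)^n" for n x
    using s_le[of n x] s_ge[of n x] by (simp add: f_def mult_left_le)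
  have summ: "summable (\<lambda>n. f n x)" for x
    by (rule summable_comparison_test'[OF summable_geometric[of "1/2"]]) (use f_norm in auto)
  have lim: "uniform_limit (topspace X) (\<lambda>n x. \<Sum>i<n. f i x) F sequentially"
    unfolding F_def by (rule Weierstrass_m_test) (use f_norm in \<open>auto intro: summable_geometric\<close>)
  show ?thesis
  proof
    have "continuous_map X euclideanreal (s n)" for n
      unfolding s_def by (rule continuous_map_SUP_seg[OF h(1,2) a])
    then have "continuous_map X euclideanreal (\<lambda>x. \<Sum>i<n. f i x)" for n
      unfolding f_def by (intro continuous_intros) auto
    then have "continuous_map X Met_TC.mtopology F"
      using uniform_limitD[OF lim] by (intro Met_TC.continuous_map_uniform_limit_alt[where F = sequentially and f = "\<lambda>n x. \<Sum>i<n. f i x"]) auto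
    then show "continuous_map X euclideanreal F" by simp
    fix x y assume xy: "x \<in> topspace X" "y \<in> topspace X" "x \<in> seg a y" "x \<noteq> y"
    \<comment> \<open>A bump at \<open>y\<close> that vanishes on \<open>seg a x\<close> makes one
      term strictly larger at \<open>y\<close>; the others are weakly monotone.\<close>
    have "y \<notin> seg a x" using seg_antisym[OF a xy(1,2,3)] xy(4) by auto
    then obtain n where n: "h n y > 0" "\<forall>z\<in>seg a x. h n z = 0"
      using h(3)[OF closedin_seg[OF a xy(1)] xy(2)] by auto
    have "s n x \<le> 0" unfolding s_def by (rule cSUP_least) (use n ne in auto)
    then have lt: "s n x < s n y" using s_upper[of y y n] n by auto
    have "0 < (\<Sum>n. f n y - f n x)"
    proof (rule suminf_pos2)
      show "summable (\<lambda>n. f n y - f n x)" by (intro summable_diff summ)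
      show "0 \<le> f n y - f n x" for n using s_mono[OF xy(3), of n] by (simp add: f_def mult_left_mono)
      show "0 < f n y - f n x" using lt by (simp add: f_def)
    qed
    then show "F x < F y" unfolding F_def using suminf_diff[OF summ[of y] summ[of x]] by linarith
  qed
qed

section \<open>Arcs inside segments\<close>

text \<open>If \<open>y\<close> is not between \<open>c\<close> and \<open>x\<close>, it lies
  between \<open>x\<close> and \<open>d\<close>. Then \<open>x\<close> is not between
  \<open>y\<close> and \<open>d\<close>, which leaves the piece from \<open>c\<close> to
  \<open>y\<close>.\<close>

lemma seg_linear:
  assumes X: "c \<in> topspace X" "d \<in> topspace X" and xy: "x \<in> seg c d" "y \<in> seg c d"
  shows "x \<in> seg c y \<or> y \<in> seg c x"
proof (cases "y \<in> seg c x \<or> x = y")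
  case False
  have xyX: "x \<in> topspace X" "y \<in> topspace X" using xy seg_subset_topspace[OF X] by auto
  have y: "y \<in> seg d x" using seg_subset_Un[OF X(1) xyX(1) X(2)] xy(2) False seg_commute by blast
  have "x \<notin> seg d y" using seg_antisym[OF X(2) xyX(2,1) y] False by auto
  then have "x \<in> seg c y" using seg_subset_Un[OF X(1) xyX(2) X(2)] xy(1) seg_commute by blast
  then show ?thesis ..
qed auto

text \<open>By \<open>seg_linear\<close> a strictly monotone map embeds \<open>seg c d\<close> into
  the reals, with an interval as image. A short subinterval that avoids the finitely many values on
  \<open>B\<close> pulls back to the arc.\<close>

lemma ex_arc_in_seg_avoiding_finite:
  assumes X: "metrizable_space X" and cd: "c \<in> topspace X" "d \<in> topspace X" "c \<noteq> d" and B: "finite B"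
  obtains C where "arc_set X C" "C \<subseteq> seg c d" "C \<inter> B = {}"
proof -
  obtain F :: "'a \<Rightarrow> real" where F: "continuous_map X euclideanreal F"
    "\<And>x y. x \<in> topspace X \<Longrightarrow> y \<in> topspace X \<Longrightarrow> x \<in> seg c y \<Longrightarrow> x \<noteq> y \<Longrightarrow> F x < F y"
    using ex_strictly_monotone_map[OF X cd(1)] by metis
  let ?J = "seg c d"
  have J: "subcontinuum X ?J" by (rule subcontinuum_seg[OF cd(1,2)])
  have JX: "?J \<subseteq> topspace X" by (rule subcontinuum_subset[OF J])
  have inj: "inj_on F ?J"
  proof (rule inj_onI, rule ccontr)
    fix x y assume xy: "x \<in> ?J" "y \<in> ?J" "F x = F y" "x \<noteq> y"
    then show False using seg_linear[OF cd(1,2) xy(1,2)] F(2)[of x y] F(2)[of y x] JX by force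
  qed
  have "compactin X ?J" "connectedin X ?J"
    using J compact closedin_compact_space by (auto simp: subcontinuum_def)
  then have "compact (F ` ?J)" "connected (F ` ?J)"
    using image_compactin[OF _ F(1)] connectedin_continuous_map_image[OF F(1)] by auto
  then obtain a b where ab: "F ` ?J = {a..b}" using connected_compact_interval_1 by metis
  have "F c \<in> {a..b}" "F d \<in> {a..b}" "F c < F d"
    unfolding ab[symmetric] using F(2)[OF cd(1,2) _ cd(3)] by auto
  then have "a < b" by auto
  then have "infinite ({a<..<b} - F ` B)" using B by simp
  then obtain t where t: "t \<in> {a<..<b} - F ` B" by (metis finite.emptyI all_not_in_conv)
  have "open ({a<..<b} - F ` B)" using B by (intro open_Diff finite_imp_closed) auto
  then obtain e where e: "e > 0" "cball t e \<subseteq> {a<..<b} - F ` B"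
    using t open_contains_cball by metis
  define a' where "a' = t - e"
  define b' where "b' = t + e"
  have ab': "a' < b'" "{a'..b'} \<subseteq> {a..b}" "{a'..b'} \<inter> F ` B = {}"
  proof -
    have sub: "{a'..b'} \<subseteq> {a<..<b} - F ` B"
      using e(2) by (simp add: a'_def b'_def cball_eq_atLeastAtMost)
    then show "{a'..b'} \<subseteq> {a..b}" "{a'..b'} \<inter> F ` B = {}"
      using greaterThanLessThan_subseteq_atLeastAtMost_iff[of a b a b] by blast+
  qed (use e(1) in \<open>simp add: a'_def b'_def\<close>)
  define C where "C = {x \<in> ?J. F x \<in> {a'..b'}}"
  have CX: "C \<subseteq> topspace X" using JX by (auto simp: C_def)
  have top: "topspace (subtopology X C) = C" using CX by auto
  have "C = ?J \<inter> {x \<in> topspace X. F x \<in> {a'..b'}}" using JX by (auto simp: C_def)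
  moreover have "closedin X {x \<in> topspace X. F x \<in> {a'..b'}}"
    by (rule closedin_continuous_map_preimage[OF F(1)]) simp
  ultimately have "closedin X C" using J by (simp add: subcontinuum_def closedin_Int)
  then have comp: "compact_space (subtopology X C)"
    using closedin_compact_space[OF compact] compact_space_subtopology by blast
  have img: "F ` C = {a'..b'}"
  proof
    show "{a'..b'} \<subseteq> F ` C"
    proof
      fix u assume u: "u \<in> {a'..b'}"
      then have "u \<in> F ` ?J" using ab ab' by auto
      then show "u \<in> F ` C" using u by (auto simp: C_def)
    qed
  qed (auto simp: C_def)
  have cont: "continuous_map (subtopology X C) (top_of_set {a'..b'}) F"
    using F(1) img top by (auto simp: continuous_map_in_subtopology continuous_map_from_subtopology)
  \<comment> \<open>A continuous bijection from a compact space onto a Hausdorff space is closed,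
    hence a homeomorphism.\<close>
  have "homeomorphic_map (subtopology X C) (top_of_set {a'..b'}) F"
  proof (rule bijective_closed_imp_homeomorphic_map[OF cont])
    show "closed_map (subtopology X C) (top_of_set {a'..b'}) F"
      by (rule continuous_imp_closed_map_gen[OF comp _ cont])
        (simp add: Hausdorff_imp_kc_space Hausdorff_space_subtopology)
    show "F ` topspace (subtopology X C) = topspace (top_of_set {a'..b'})"
      using img top by simp
    show "inj_on F (topspace (subtopology X C))"
      unfolding top using inj by (rule inj_on_subset) (auto simp: C_def)
  qed
  then have "subtopology X C homeomorphic_space top_of_set {a'..b'}"
    by (rule homeomorphic_map_imp_homeomorphic_space)
  then have "arc_set X C" unfolding arc_set_def using CX ab'(1) by blast
  moreover have "C \<inter> B = {}" using ab'(3) by (auto simp: C_def)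
  ultimately show ?thesis using that[of C] by (auto simp: C_def)
qed

section \<open>Components of the complement of a point\<close>

text \<open>Every point other than \<open>b\<close> has a connected neighbourhood missing
  \<open>b\<close>, which lies in \<open>C\<close> or misses \<open>C\<close>. So \<open>C\<close>
  and the remaining components are open sides of a cut at \<open>b\<close>.\<close>

lemma branch_at_point:
  assumes b: "b \<in> topspace X"
    and C: "C \<in> connected_components_of (subtopology X (topspace X - {b}))"
  shows "subcontinuum X (insert b C)" and "subcontinuum X (topspace X - C)"
proof -
  let ?T = "subtopology X (topspace X - {b})"
  have C': "connectedin X C" "C \<subseteq> topspace X - {b}"
    using connectedin_connected_components_of[OF C] by (auto simp: connectedin_subtopology)
  have nbhd: "\<exists>U. openin X U \<and> y \<in> U \<and> (U \<subseteq> C \<or> U \<subseteq> topspace X - {b} - C)"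
    if y: "y \<in> topspace X" "y \<noteq> b" for y
  proof -
    obtain N U where N: "subcontinuum X N" "openin X U" "y \<in> U" "U \<subseteq> N" "b \<notin> N"
      using subcontinuum_nbhd_avoiding_point[OF y(1) b y(2)] by metis
    have "connectedin ?T N" "N \<subseteq> topspace X - {b}"
      using N subcontinuum_subset[OF N(1)] by (auto simp: connectedin_subtopology subcontinuum_def)
    then have "N \<subseteq> C \<or> N \<subseteq> topspace X - {b} - C"
      using connected_components_of_maximal[OF C] unfolding disjnt_def by blast
    then show ?thesis using N by blast
  qed
  have opC: "openin X C"
  proof (subst openin_subopen, intro ballI)
    fix y assume "y \<in> C"
    then have "y \<in> topspace X" "y \<noteq> b" using C' by auto
    from nbhd[OF this] obtain U where U: "openin X U" "y \<in> U" "U \<subseteq> C \<or> U \<subseteq> topspace X - {b} - C"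
      by blast
    then have "\<not> U \<subseteq> topspace X - {b} - C" using \<open>y \<in> C\<close> by auto
    then show "\<exists>T. openin X T \<and> y \<in> T \<and> T \<subseteq> C" using U by blast
  qed
  have opD: "openin X (topspace X - {b} - C)"
  proof (subst openin_subopen, intro ballI)
    fix y assume y: "y \<in> topspace X - {b} - C"
    then have "y \<in> topspace X" "y \<noteq> b" by auto
    from nbhd[OF this] obtain U where U: "openin X U" "y \<in> U" "U \<subseteq> C \<or> U \<subseteq> topspace X - {b} - C"
      by blast
    then have "\<not> U \<subseteq> C" using y by auto
    then show "\<exists>T. openin X T \<and> y \<in> T \<and> T \<subseteq> topspace X - {b} - C" using U by blast
  qed
  show "subcontinuum X (insert b C)"
    by (rule subcontinuum_insert_side[OF connected opC opD _ _ b]) (use C' in auto)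
  have "subcontinuum X (insert b (topspace X - {b} - C))"
    by (rule subcontinuum_insert_side[OF connected opD opC _ _ b]) (use C' in auto)
  moreover have "insert b (topspace X - {b} - C) = topspace X - C" using C' b by auto
  ultimately show "subcontinuum X (topspace X - C)" by simp
qed

text \<open>Of at least three components, at most one contains \<open>c\<close> and at most one
  contains \<open>d\<close>. A component \<open>C\<close> with neither misses the segment, since
  each of its points other than \<open>b\<close> is joined to \<open>c\<close> or \<open>d\<close>
  by a segment avoiding \<open>b\<close>.\<close>

lemma branch_point_off_seg:
  assumes cd: "c \<in> topspace X" "d \<in> topspace X" and b: "branch_point X b"
  obtains C where "C \<in> connected_components_of (subtopology X (topspace X - {b}))" "C \<inter> seg c d = {}"
proof -
  let ?T = "subtopology X (topspace X - {b})"
  let ?K = "connected_components_of ?T"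
  let ?A = "\<lambda>c. {C \<in> ?K. c \<in> C}"
  have bX: "b \<in> topspace X" and K: "infinite ?K \<or> 3 \<le> card ?K"
    using b by (auto simp: branch_point_def Let_def)
  have one: "finite (?A c) \<and> card (?A c) \<le> 1" for c
  proof (cases "?A c = {}")
    case True
    then show ?thesis by (metis card.empty finite.emptyI zero_le)
  next
    case False
    then obtain C where C: "C \<in> ?A c" by blast
    then have "?A c \<subseteq> {C}" using connected_components_of_overlap[of _ ?T C] by blast
    then show ?thesis using card_mono[of "{C}" "?A c"] finite_subset[of "?A c" "{C}"] by auto
  qed
  have "\<exists>C\<in>?K. C \<notin> ?A c \<union> ?A d"
  proof (rule ccontr)
    assume "\<not> ?thesis"
    then have sub: "?K \<subseteq> ?A c \<union> ?A d" by blast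
    have fin: "finite (?A c \<union> ?A d)" using one by blast
    have "card ?K \<le> card (?A c \<union> ?A d)" by (rule card_mono[OF fin sub])
    also have "\<dots> \<le> card (?A c) + card (?A d)" by (rule card_Un_le)
    also have "\<dots> \<le> 2" using one[of c] one[of d] by linarith
    finally show False using K finite_subset[OF sub fin] by simp
  qed
  then obtain C where C: "C \<in> ?K" "c \<notin> C" "d \<notin> C" by blast
  have CT: "C \<subseteq> topspace X - {b}" using connected_components_of_subset[OF C(1)] by auto
  have not_in: "x \<notin> C" if "b \<notin> seg e x" "e \<notin> C" "e \<in> topspace X" for e x
  proof
    assume x: "x \<in> C"
    then have xX: "x \<in> topspace X" using CT by auto
    have "connectedin ?T (seg e x)"
      using subcontinuum_seg[OF that(3) xX] subcontinuum_subset[OF subcontinuum_seg[OF that(3) xX]] that(1)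
      by (auto simp: connectedin_subtopology subcontinuum_def)
    moreover have "\<not> disjnt C (seg e x)" using x seg_right unfolding disjnt_def by blast
    ultimately have "seg e x \<subseteq> C" by (rule connected_components_of_maximal[OF C(1)])
    then show False using that(2) seg_left by blast
  qed
  have "x \<notin> C" if x: "x \<in> seg c d" for x
  proof (cases "x = b")
    case True then show ?thesis using CT by auto
  next
    case False
    have xX: "x \<in> topspace X" using x seg_subset_topspace[OF cd] by auto
    consider "x \<in> seg c b" | "x \<in> seg d b"
      using seg_subset_Un[OF cd(1) bX cd(2)] x seg_commute by blast
    then show ?thesis
    proof cases
      case 1
      then have "b \<notin> seg c x" using seg_antisym[OF cd(1) xX bX] False by auto
      then show ?thesis using not_in C cd by blast
    next
      case 2
      then have "b \<notin> seg d x" using seg_antisym[OF cd(2) xX bX] False by auto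
      then show ?thesis using not_in C cd by blast
    qed
  qed
  then show ?thesis using that[OF C(1)] by blast
qed

end

section \<open>Branch points as gates when \<open>Y\<close> is the whole space\<close>

context dendron_action_core
begin

lemma minimal_set_eq_topspace:
  assumes X: "metrizable_space X" and Y: "Y = topspace X" and free: "\<not> (\<exists>C. free_arc X C)"
    and M: "minimal_set G X \<phi> M"
  shows "M = topspace X"
proof (rule ccontr)
  assume "M \<noteq> topspace X"
  note D = minimal_setD[OF M]
  then obtain c where c: "c \<in> topspace X" "c \<notin> M" using \<open>M \<noteq> topspace X\<close> by blast
  obtain N U where N: "subcontinuum X N" "openin X U" "c \<in> U" "U \<subseteq> N" "N \<inter> M = {}"
    using subcontinuum_nbhd_avoiding_closed[OF c(1) D(2) c(2)] by metis
  \<comment> \<open>Otherwise \<open>c\<close> would be an isolated point of an infinite connected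
    space.\<close>
  have "N \<noteq> {c}"
  proof
    assume "N = {c}"
    then have "U = {c}" using N by auto
    then have "openin X {c}" "closedin X {c}" using N \<open>N = {c}\<close> by (auto simp: subcontinuum_def)
    then have "topspace X = {c}" using connected unfolding connected_space_clopen_in by blast
    then show False
      using infinite_invariant[OF core(2) core_subset] core(1) Y by (simp add: subcontinuum_def)
  qed
  then obtain d where d: "d \<in> N" "c \<noteq> d" using N by blast
  have dX: "d \<in> topspace X" using d subcontinuum_subset[OF N(1)] by auto
  let ?J = "seg c d"
  have J: "subcontinuum X ?J" by (rule subcontinuum_seg[OF c(1) dX])
  have JM: "M \<inter> ?J = {}" using seg_subset[OF N(1), of c d] N d by blast
  have fin: "finite (gate ?J ` M)" by (rule finite_gate_image[OF J D(2) JM])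
  have branch: "b \<in> gate ?J ` M" if b: "branch_point X b" "b \<in> ?J" for b
  proof -
    have bX: "b \<in> topspace X" using b by (simp add: branch_point_def)
    obtain C where C: "C \<in> connected_components_of (subtopology X (topspace X - {b}))" "C \<inter> ?J = {}"
      using branch_point_off_seg[OF c(1) dX b(1)] by metis
    note bC = branch_at_point[OF bX C(1)]
    have "C \<noteq> {}" "C \<subseteq> topspace X"
      using nonempty_connected_components_of[OF C(1)] connected_components_of_subset[OF C(1)] by auto
    then have "topspace X - C \<subset> Y" using Y by blast
    then obtain g where g: "g \<in> carrier G" "\<phi> g ` (topspace X - C) \<inter> (topspace X - C) = {}"
      using ex_disjoint_translate[OF bC(2)] by auto
    \<comment> \<open>The complement of \<open>C\<close> has a translate disjoint from it and so
      cannot contain the invariant set \<open>M\<close>. A point of \<open>M\<close> in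
      \<open>C\<close> then reaches the segment through \<open>insert b C\<close>, which meets it
      only in \<open>b\<close>.\<close>
    have "M \<inter> C \<noteq> {}"
    proof
      assume "M \<inter> C = {}"
      then have "M \<subseteq> topspace X - C" using D by auto
      then have "\<phi> g ` M \<subseteq> (topspace X - C) \<inter> \<phi> g ` (topspace X - C)"
        using invariant_eq[OF D(3,4) g(1)] by blast
      then show False using g D(1) by blast
    qed
    then obtain m where m: "m \<in> M" "m \<in> C" by auto
    then have mX: "m \<in> topspace X" using D by auto
    have "gate ?J m \<in> insert b C" by (rule gate_mem[OF J mX bC(1)]) (use m b in auto)
    then have "gate ?J m = b" using gate_in[OF J mX] C(2) by auto
    then show ?thesis using m by blast
  qed
  obtain C where C: "arc_set X C" "C \<subseteq> ?J" "C \<inter> gate ?J ` M = {}"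
    using ex_arc_in_seg_avoiding_finite[OF X c(1) dX d(2) fin] by metis
  then have "\<not> branch_point X b" if "b \<in> C" for b
    using branch[of b] that by auto
  then have "free_arc X C" using C(1) by (simp add: free_arc_def)
  then show False using free by blast
qed

end

theorem theorem5p2:
  fixes G :: "('g, 'm) monoid_scheme"
    and X :: "'a topology"
    and \<phi> :: "'g \<Rightarrow> 'a \<Rightarrow> 'a"
  assumes "dendrite X"
    and "homeo_action G X \<phi>"
    and "\<forall>x \<in> topspace X. infinite (orbit G \<phi> x)"
  shows "(\<exists>!M. minimal_set G X \<phi> M \<and> infinite M) \<and>
         (\<forall>M. minimal_set G X \<phi> M \<and> infinite M \<longrightarrow>
            (dendro_minimal G X \<phi> \<and> \<not> (\<exists>C. free_arc X C) \<longrightarrow> M = topspace X) \<and>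
            extremely_proximal G (subtopology X M) (restrict_action \<phi> M)) \<and>
         proximal_action G X \<phi>"
proof -
  interpret dendron_action X G \<phi>
    using assms by unfold_locales (auto simp: dendrite_def)
  obtain Y where "subcontinuum X Y" "invariant_set G \<phi> Y"
    "\<And>K. subcontinuum X K \<Longrightarrow> invariant_set G \<phi> K \<Longrightarrow> K \<subseteq> Y \<Longrightarrow> K = Y"
    using ex_minimal_invariant_subcontinuum by metis
  then interpret dendron_action_core X G \<phi> Y
    by unfold_locales
  have inf: "infinite M" if "minimal_set G X \<phi> M" for M
    using infinite_invariant minimal_setD[OF that] by blast
  have "\<exists>!M. minimal_set G X \<phi> M \<and> infinite M"
  proof (rule ex1I)
    show M: "minimal_set G X \<phi> {e. core_end e} \<and> infinite {e. core_end e}"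
      using inf minimal_set_iff_core_ends[of "{e. core_end e}"] by simp
    show "M = {e. core_end e}" if "minimal_set G X \<phi> M \<and> infinite M" for M
      using that minimal_set_iff_core_ends[of M] by simp
  qed
  moreover have "M = topspace X"
    if "minimal_set G X \<phi> M" "dendro_minimal G X \<phi>" "\<not> (\<exists>C. free_arc X C)" for M
  proof -
    \<comment> \<open>As a nonempty invariant subdendron, \<open>Y\<close> is everything by
      dendro-minimality.\<close>
    have "Y = topspace X"
      using that(2) dendron_subcontinuum[OF core(1)] core core_subset
      unfolding dendro_minimal_def subcontinuum_def by blast
    then show ?thesis
      using minimal_set_eq_topspace that assms(1) unfolding dendrite_def by blast
  qed
  ultimately show ?thesis
    using extremely_proximal_minimal_set proximal by simp
qed

end
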